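(* For any $d>1$, there is a (finite) fugacity $\lambda$ for which the hard-core model with fugacity $\lambda$ on the random $\mathrm{Poisson}(d)$ tree lacks strong spatial mixing, with positive probability. The reason is that, for some constant $c$, the $\mathrm{Poisson}(d)$ tree possesses, with positive probability, subgraphs that are "stretched" versions of the infinite binary tree, which branch every $c$ generations, and such trees lack weak spatial mixing for sufficiently large $\lambda$.
   Context: Poisson tree: for $d>0$, $\mathrm{Poisson}(d)$ denotes the random rooted tree in which every vertex independently has a random number of children with distribution $\Pr(X=i)=e^{-d}d^i/i!$, $i\ge 0$ (the Galton–Watson tree with Poisson offspring of mean $d$). Stretched binary tree branching every $c$ generations: an infinite rooted tree in which the vertices of every $c$-th generation have two children each and all other vertices have exactly one child. Hard-core model with finite fugacity $\lambda>0$ on a locally finite graph $G$: configurations are independent sets of $G$ (each vertex is "occupied" or "unoccupied", no two adjacent vertices are occupied). For a finite vertex set $\Psi$, let $\partial\Psi=\{v\in\Psi : v \text{ has a neighbor not in } \Psi\}$. For a boundary condition $\sigma$ on $\partial\Psi$ (an assignment of occupied/unoccupied with no two adjacent occupied vertices), $\mu_\Psi^\sigma$ is the probability distribution on independent sets $S$ of the subgraph induced by $\Psi$ that agree with $\sigma$ on $\partial\Psi$, with probability proportional to $\lambda^{|S|}$. Weak spatial mixing (WSM): for every finite vertex set $\Lambda$, and every sequence of triples $(\Psi_n,\sigma_n,\tau_n)$ with $\Psi_n\supset\Lambda$ finite and $\sigma_n,\tau_n$ boundary conditions on $\partial\Psi_n$, if $\mathrm{dist}(\Lambda,\partial\Psi_n)\to\infty$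 then $\|\mu_{\Psi_n}^{\sigma_n}-\mu_{\Psi_n}^{\tau_n}\|_\Lambda\to 0$, where $\|\cdot\|_\Lambda$ is the total variation distance between the marginals on $\Lambda$ (distance to the empty set is $+\infty$). Strong spatial mixing (SSM): the analogous property in which only the set of vertices on which the two boundary conditions disagree is required to be at distance tending to infinity from $\Lambda$ (nearer vertices may be frozen identically in both). For independent sets this is equivalent to the following, which is the form used here: SSM holds on $G$ if and only if WSM holds for the hard-core model (with the same fugacity) on every subgraph of $G$. *)

theory Defs
  imports "HOL-Probability.Probability"
begin

section \<open>Graphs\<close>

text \<open>An undirected edge is represented by both of its ordered pairs.\<close>

record 'v ugraph =
  verts :: "'v set"
  adj :: "('v \<times> 'v) set"

definition simple_graph :: "'v ugraph \<Rightarrow> bool" where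
  "simple_graph G \<longleftrightarrow> adj G \<subseteq> verts G \<times> verts G \<and> sym (adj G) \<and> irrefl (adj G)"

definition locally_finite :: "'v ugraph \<Rightarrow> bool" where
  "locally_finite G \<longleftrightarrow> (\<forall>v\<in>verts G. finite (adj G `` {v}))"

text \<open>Subgraphs need not be induced.\<close>

definition subgraph :: "'v ugraph \<Rightarrow> 'v ugraph \<Rightarrow> bool" where
  "subgraph H G \<longleftrightarrow> simple_graph H \<and> verts H \<subseteq> verts G \<and> adj H \<subseteq> adj G"

definition graph_iso :: "'v ugraph \<Rightarrow> 'w ugraph \<Rightarrow> bool" where
  "graph_iso G H \<longleftrightarrow> (\<exists>f. bij_betw f (verts G) (verts H) \<and>
     (\<forall>u\<in>verts G. \<forall>v\<in>verts G. (u, v) \<in> adj G \<longleftrightarrow> (f u, f v) \<in> adj H))"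

text \<open>The infimum of the empty set is \<open>\<infinity>\<close> in \<^typ>\<open>enat\<close>, so vertices in different
  components, and any set and the empty set, are at distance \<open>\<infinity>\<close>.\<close>

definition gdist :: "'v ugraph \<Rightarrow> 'v \<Rightarrow> 'v \<Rightarrow> enat" where
  "gdist G u v = (INF n\<in>{n. (u, v) \<in> adj G ^^ n}. enat n)"

definition set_dist :: "'v ugraph \<Rightarrow> 'v set \<Rightarrow> 'v set \<Rightarrow> enat" where
  "set_dist G A B = (INF u\<in>A. INF v\<in>B. gdist G u v)"

section \<open>The hard-core model\<close>

definition indep :: "'v ugraph \<Rightarrow> 'v set \<Rightarrow> bool" where
  "indep G S \<longleftrightarrow> S \<subseteq> verts G \<and> (\<forall>u\<in>S. \<forall>v\<in>S. (u, v) \<notin> adj G)"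

definition boundary :: "'v ugraph \<Rightarrow> 'v set \<Rightarrow> 'v set" where
  "boundary G \<Psi> = {v\<in>\<Psi>. \<exists>w. (v, w) \<in> adj G \<and> w \<notin> \<Psi>}"

text \<open>A boundary condition is identified with its set of occupied vertices.\<close>

definition boundary_cond :: "'v ugraph \<Rightarrow> 'v set \<Rightarrow> 'v set \<Rightarrow> bool" where
  "boundary_cond G \<Psi> \<sigma> \<longleftrightarrow> \<sigma> \<subseteq> boundary G \<Psi> \<and> indep G \<sigma>"

definition configs :: "'v ugraph \<Rightarrow> 'v set \<Rightarrow> 'v set \<Rightarrow> 'v set set" where
  "configs G \<Psi> \<sigma> = {S. S \<subseteq> \<Psi> \<and> indep G S \<and> S \<inter> boundary G \<Psi> = \<sigma>}"

text \<open>Meaningful for finite \<open>\<Psi>\<close>, boundary conditions \<open>\<sigma>\<close> and \<open>\<lambda> > 0\<close>;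
  see the lemma \<open>pmf_hardcore\<close> below.\<close>

definition hardcore :: "real \<Rightarrow> 'v ugraph \<Rightarrow> 'v set \<Rightarrow> 'v set \<Rightarrow> 'v set pmf" where
  "hardcore fug G \<Psi> \<sigma> = embed_pmf (\<lambda>S. if S \<in> configs G \<Psi> \<sigma>
     then fug ^ card S / (\<Sum>T\<in>configs G \<Psi> \<sigma>. fug ^ card T) else 0)"

definition total_variation :: "'a pmf \<Rightarrow> 'a pmf \<Rightarrow> real" where
  "total_variation p q = (SUP A. \<bar>measure_pmf.prob p A - measure_pmf.prob q A\<bar>)"

definition marginal_dist :: "'v set \<Rightarrow> 'v set pmf \<Rightarrow> 'v set pmf \<Rightarrow> real" where
  "marginal_dist \<Lambda> p q =
     total_variation (map_pmf (\<lambda>S. S \<inter> \<Lambda>) p) (map_pmf (\<lambda>S. S \<inter> \<Lambda>) q)"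

definition WSM :: "real \<Rightarrow> 'v ugraph \<Rightarrow> bool" where
  "WSM fug G \<longleftrightarrow> (\<forall>\<Lambda> \<Psi> \<sigma> \<tau>. finite \<Lambda> \<longrightarrow> \<Lambda> \<subseteq> verts G \<longrightarrow>
     (\<forall>n. finite (\<Psi> n) \<and> \<Lambda> \<subseteq> \<Psi> n \<and> \<Psi> n \<subseteq> verts G \<and>
        boundary_cond G (\<Psi> n) (\<sigma> n) \<and> boundary_cond G (\<Psi> n) (\<tau> n)) \<longrightarrow>
     (\<lambda>n. set_dist G \<Lambda> (boundary G (\<Psi> n))) \<longlonglongrightarrow> \<infinity> \<longrightarrow>
     (\<lambda>n. marginal_dist \<Lambda> (hardcore fug G (\<Psi> n) (\<sigma> n)) (hardcore fug G (\<Psi> n) (\<tau> n)))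
       \<longlonglongrightarrow> 0)"

definition SSM :: "real \<Rightarrow> 'v ugraph \<Rightarrow> bool" where
  "SSM fug G \<longleftrightarrow> (\<forall>H. subgraph H G \<longrightarrow> WSM fug H)"

section \<open>Random trees\<close>

text \<open>Ulam--Harris encoding: a vertex is the list of child indices on the path from the root
  \<open>[]\<close>, and \<open>N v\<close> is the number of children of \<open>v\<close>. The values of \<open>N\<close> at lists that are
  not vertices of the tree are irrelevant.\<close>

inductive_set tree_verts :: "(nat list \<Rightarrow> nat) \<Rightarrow> nat list set" for N where
  root: "[] \<in> tree_verts N"
| child: "v \<in> tree_verts N \<Longrightarrow> i < N v \<Longrightarrow> v @ [i] \<in> tree_verts N"

definition tree_graph :: "(nat list \<Rightarrow> nat) \<Rightarrow> nat list ugraph" where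
  "tree_graph N = \<lparr>verts = tree_verts N,
     adj = {(u, v). u \<in> tree_verts N \<and> v \<in> tree_verts N \<and> (\<exists>i. v = u @ [i] \<or> u = v @ [i])}\<rparr>"

definition poisson_tree_space :: "real \<Rightarrow> (nat list \<Rightarrow> nat) measure" where
  "poisson_tree_space d = (\<Pi>\<^sub>M v\<in>UNIV. measure_pmf (poisson_pmf d))"

text \<open>The generations are numbered from 0, the root being in generation 0.\<close>

definition stretched_binary_tree :: "nat \<Rightarrow> nat list ugraph" where
  "stretched_binary_tree c = tree_graph (\<lambda>v. if c dvd length v then 2 else 1)"

text \<open>For a measurable property this says that its probability is positive; in general
  it says that its inner probability is positive.\<close>

definition with_positive_prob :: "'a measure \<Rightarrow> ('a \<Rightarrow> bool) \<Rightarrow> bool" where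
  "with_positive_prob M P \<longleftrightarrow> (\<exists>A\<in>sets M. measure M A > 0 \<and> (\<forall>x\<in>A. P x))"

section \<open>Sanity checks\<close>

lemma pmf_hardcore:
  assumes "fug > 0" "finite \<Psi>" "boundary_cond G \<Psi> \<sigma>"
  shows "pmf (hardcore fug G \<Psi> \<sigma>) S = (if S \<in> configs G \<Psi> \<sigma>
     then fug ^ card S / (\<Sum>T\<in>configs G \<Psi> \<sigma>. fug ^ card T) else 0)"
proof -
  let ?C = "configs G \<Psi> \<sigma>"
  let ?Z = "\<Sum>T\<in>?C. fug ^ card T"
  let ?f = "\<lambda>S. if S \<in> ?C then fug ^ card S / ?Z else 0"
  have fin: "finite ?C"
    using assms(2) by (auto intro: finite_subset[of _ "Pow \<Psi>"] simp: configs_def)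
  have "\<sigma> \<in> ?C"
    using assms(3) by (auto simp: configs_def boundary_cond_def boundary_def)
  then have Z: "?Z > 0"
    using fin assms(1) by (intro sum_pos) auto
  have nonneg: "?f S \<ge> 0" for S
    using Z assms(1) by auto
  have "(\<integral>\<^sup>+S. ennreal (?f S) \<partial>count_space UNIV) = (\<Sum>S\<in>?C. ennreal (?f S))"
    by (rule nn_integral_count_space'[OF fin]) auto
  also have "\<dots> = ennreal (\<Sum>S\<in>?C. ?f S)"
    by (rule sum_ennreal) (rule nonneg)
  also have "(\<Sum>S\<in>?C. ?f S) = 1"
    using Z by (simp add: sum_divide_distrib[symmetric])
  finally have one: "(\<integral>\<^sup>+S. ennreal (?f S) \<partial>count_space UNIV) = 1"
    by simp
  show ?thesis
    unfolding hardcore_def by (rule pmf_embed_pmf[OF nonneg one])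
qed

lemma simple_graph_tree_graph: "simple_graph (tree_graph N)"
  by (auto simp: simple_graph_def tree_graph_def sym_def irrefl_def)

lemma tree_verts_snocD: "u @ [i] \<in> tree_verts N \<Longrightarrow> i < N u"
  by (erule tree_verts.cases) auto

lemma locally_finite_tree_graph: "locally_finite (tree_graph N)"
proof -
  have "adj (tree_graph N) `` {v} \<subseteq> insert (butlast v) ((\<lambda>i. v @ [i]) ` {..<N v})" for v
    by (auto simp: tree_graph_def dest: tree_verts_snocD)
  then show ?thesis
    unfolding locally_finite_def by (blast intro: finite_subset)
qed

lemma prob_space_poisson_tree_space: "prob_space (poisson_tree_space d)"
  unfolding poisson_tree_space_def
  by (intro prob_space_PiM) (rule prob_space_measure_pmf)

end

theory Submission
  imports Defs
begin

text \<open>Call a tree \<open>(n+1)\<close>-good if its root has exactly two children and each of them has an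
  \<open>n\<close>-good subtree hanging \<open>2m\<close> generations below it. By independence of subtrees, the
  probability \<open>x\<close> of reaching a set \<open>k\<close> generations below becomes \<open>1 - exp (-d x)\<close> for
  \<open>k + 1\<close>, and this map expands near 0 since \<open>d > 1\<close>. Hence for large \<open>m\<close> the
  probability of being \<open>n\<close>-good is bounded below uniformly in \<open>n\<close>. By compactness, a tree that
  is \<open>n\<close>-good for all \<open>n\<close> contains a stretched binary tree branching every \<open>c = 2m+1\<close>
  generations.

  The probability \<open>y\<close> that the root of a tree is unoccupied is
  \<open>1 / (1 + \<lambda> y\<^sub>1 \<cdots> y\<^sub>b)\<close> in terms of the subtrees at its \<open>b\<close> children. For odd \<open>c\<close> and large
  \<open>\<lambda>\<close>, composing \<open>c\<close> such steps maps \<open>[1/2, 1]\<close> into \<open>[0, u]\<close> and \<open>[0, u]\<close> into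
  \<open>[1/2, 1]\<close>, where \<open>u \<le> 1/4\<close>. So at depths divisible by \<open>c\<close> the fully occupied and the empty
  boundary keep different marginals at the root. For even \<open>c\<close> the composition is increasing
  instead, and for \<open>c = 2\<close> it has only one fixed point, whatever \<open>\<lambda>\<close> is.\<close>

section \<open>Independence of subtrees\<close>

definition subtree :: "nat \<Rightarrow> (nat list \<Rightarrow> nat) \<Rightarrow> nat list \<Rightarrow> nat" where
  "subtree i N = (\<lambda>v. N (i # v))"

definition offspring :: "nat \<Rightarrow> (nat list \<Rightarrow> nat) set \<Rightarrow> (nat list \<Rightarrow> nat) set" where
  "offspring b E = {N. N [] = b \<and> (\<forall>i<b. subtree i N \<in> E)}"

lemma space_poisson_tree_space [simp]: "space (poisson_tree_space d) = UNIV"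
  by (simp add: poisson_tree_space_def space_PiM)

lemma measurable_subtree [measurable]:
  "subtree i \<in> poisson_tree_space d \<rightarrow>\<^sub>M poisson_tree_space d"
  unfolding poisson_tree_space_def subtree_def
  by (intro measurable_PiM_single') (auto simp: space_PiM)

lemma measurable_root_degree [measurable]:
  "(\<lambda>N. N []) \<in> poisson_tree_space d \<rightarrow>\<^sub>M count_space UNIV"
proof -
  have "(\<lambda>N. N []) \<in> poisson_tree_space d \<rightarrow>\<^sub>M measure_pmf (poisson_pmf d)"
    unfolding poisson_tree_space_def by (rule measurable_component_singleton) simp
  then show ?thesis by (simp cong: measurable_cong_sets)
qed

lemma sets_subtree_vimage [measurable]:
  assumes "E \<in> sets (poisson_tree_space d)"
  shows "{N. subtree i N \<in> E} \<in> sets (poisson_tree_space d)"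
  using measurable_sets[OF measurable_subtree assms, of i] by (simp add: vimage_def)

lemma sets_root_degree: "{N. N [] = b} \<in> sets (poisson_tree_space d)"
  using measurable_sets[OF measurable_root_degree, of "{b}" d] by (simp add: vimage_def)

lemma sets_offspring:
  assumes "E \<in> sets (poisson_tree_space d)"
  shows "offspring b E \<in> sets (poisson_tree_space d)"
proof -
  have "offspring b E = {N. N [] = b} \<inter> (\<Inter>i\<in>{..<b}. {N. subtree i N \<in> E}) \<inter> space (poisson_tree_space d)"
    by (auto simp: offspring_def)
  also have "\<dots> \<in> sets (poisson_tree_space d)"
    by (cases "b = 0")
       (auto intro!: sets.Int sets.finite_INT sets_root_degree sets_subtree_vimage assms
         simp del: space_poisson_tree_space)
  finally show ?thesis .
qed

text \<open>Prefixing with \<open>i\<close> is injective, so the counts below child \<open>i\<close>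
  are again an independent family with the same law. Since \<open>N\<close> has a value at every
  list, no conditioning on \<open>i < N []\<close> is involved.\<close>

lemma distr_subtree:
  "distr (poisson_tree_space d) (poisson_tree_space d) (subtree i) = poisson_tree_space d"
proof -
  have "distr (PiM UNIV (\<lambda>_::nat list. measure_pmf (poisson_pmf d)))
          (PiM UNIV (\<lambda>_. measure_pmf (poisson_pmf d)))
          (\<lambda>\<omega>. \<lambda>v\<in>UNIV. \<omega> (i # v)) = PiM UNIV (\<lambda>_. measure_pmf (poisson_pmf d))"
    by (rule distr_PiM_reindex) (auto intro: prob_space_measure_pmf)
  then show ?thesis
    unfolding poisson_tree_space_def by (simp add: subtree_def [abs_def] restrict_def)
qed

lemma measure_subtree:
  assumes "E \<in> sets (poisson_tree_space d)"
  shows "measure (poisson_tree_space d) {N. subtree i N \<in> E} = measure (poisson_tree_space d) E"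
  using measure_distr[OF measurable_subtree assms, of i] 
  by (simp add: distr_subtree vimage_def)

lemma measure_root_degree:
  "measure (poisson_tree_space d) {N. N [] = b} = pmf (poisson_pmf d) b"
proof -
  have "measure (poisson_tree_space d) {N \<in> space (poisson_tree_space d). N [] \<in> {b}} = measure (measure_pmf (poisson_pmf d)) {b}"
  proof -
    have "distr (poisson_tree_space d) (measure_pmf (poisson_pmf d)) (\<lambda>N. N []) = measure_pmf (poisson_pmf d)"
      unfolding poisson_tree_space_def
      by (rule distr_PiM_component) (auto intro: prob_space_measure_pmf)
    then show ?thesis
      using measure_distr[of "\<lambda>N. N []" "poisson_tree_space d" "measure_pmf (poisson_pmf d)" "{b}"]
      by (simp add: vimage_def measurable_root_degree cong: measurable_cong_sets)
  qed
  then show ?thesis by (simp add: pmf.rep_eq)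
qed

text \<open>The root and the lists starting with a given child index form disjoint blocks of
  coordinates, so the root degree and the subtrees are independent.\<close>

lemma measure_offspring:
  assumes E: "E \<in> sets (poisson_tree_space d)"
  shows "measure (poisson_tree_space d) (offspring b E) =
    pmf (poisson_pmf d) b * measure (poisson_tree_space d) E ^ b"
proof -
  let ?P = "poisson_tree_space d"
  let ?M = "\<lambda>_::nat list. measure_pmf (poisson_pmf d)"
  interpret prob_space ?P by (rule prob_space_poisson_tree_space)
  \<comment> \<open>Block 0 is the root and block \<open>Suc i\<close> belongs to child
    \<open>i\<close>, so \<open>b\<close> children use the blocks 0 to \<open>b\<close>.\<close>
  define K :: "nat \<Rightarrow> nat list set" where "K j = (case j of 0 \<Rightarrow> {[]} | Suc i \<Rightarrow> range (Cons i))" for j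
  define A where "A j = (case j of 0 \<Rightarrow> {f \<in> space (PiM (K 0) ?M). f [] = b}
      | Suc i \<Rightarrow> {f \<in> space (PiM (K j) ?M). (\<lambda>v. f (i # v)) \<in> E})" for j
  have ind: "indep_vars ?M (\<lambda>v N. N v) UNIV"
  proof (subst indep_vars_iff_distr_eq_PiM')
    have "distr ?P (?M v) (\<lambda>N. N v) = ?M v" for v
      unfolding poisson_tree_space_def
      by (rule distr_PiM_component) (auto intro: prob_space_measure_pmf)
    moreover have "distr ?P (PiM UNIV ?M) (\<lambda>N. \<lambda>v\<in>UNIV. N v) = PiM UNIV ?M"
      by (simp add: poisson_tree_space_def restrict_def)
    ultimately show "distr ?P (PiM UNIV ?M) (\<lambda>N. \<lambda>v\<in>UNIV. N v) =
        PiM UNIV (\<lambda>v. distr ?P (?M v) (\<lambda>N. N v))"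
      by simp
  next
    show "random_variable (?M v) (\<lambda>N. N v)" for v
      unfolding poisson_tree_space_def by (rule measurable_component_singleton) simp
  qed simp
  have "indep_vars (\<lambda>j. PiM (K j) ?M) (\<lambda>j N. restrict (\<lambda>v. N v) (K j)) {..b}"
    by (rule indep_vars_restrict[OF ind])
       (auto simp: K_def disjoint_family_on_def split: nat.splits)
  moreover have "A j \<in> sets (PiM (K j) ?M)" for j
  proof (cases j)
    case 0
    then have "A j = (\<lambda>f. f []) -` {b} \<inter> space (PiM (K j) ?M)" by (auto simp: A_def)
    also have "\<dots> \<in> sets (PiM (K j) ?M)"
      by (rule measurable_sets, rule measurable_component_singleton) (auto simp: K_def 0)
    finally show ?thesis .
  next
    case (Suc i)
    then have "A j = (\<lambda>f v. f (i # v)) -` E \<inter> space (PiM (K j) ?M)" by (auto simp: A_def)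
    also have "\<dots> \<in> sets (PiM (K j) ?M)"
    proof (rule measurable_sets[OF _ E])
      show "(\<lambda>f v. f (i # v)) \<in> PiM (K j) ?M \<rightarrow>\<^sub>M ?P"
        unfolding poisson_tree_space_def
        by (intro measurable_PiM_single' measurable_component_singleton) (auto simp: K_def Suc)
    qed
    finally show ?thesis .
  qed
  ultimately have "prob (\<Inter>j\<in>{..b}. (\<lambda>N. restrict N (K j)) -` A j \<inter> space ?P) =
      (\<Prod>j\<in>{..b}. prob ((\<lambda>N. restrict N (K j)) -` A j \<inter> space ?P))"
    by (intro indep_varsD) auto
  moreover have pre0: "(\<lambda>N. restrict N (K 0)) -` A 0 \<inter> space ?P = {N. N [] = b}"
    by (auto simp: A_def K_def space_PiM)
  moreover have preS: "(\<lambda>N. restrict N (K (Suc i))) -` A (Suc i) \<inter> space ?P = {N. subtree i N \<in> E}" for i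
    by (auto simp: A_def K_def space_PiM subtree_def)
  moreover have "(\<Inter>j\<in>{..b}. (\<lambda>N. restrict N (K j)) -` A j \<inter> space ?P) = offspring b E"
    unfolding atMost_Suc_eq_insert_0 lessThan_Suc_atMost[symmetric] lessThan_Suc_eq_insert_0
    using pre0 preS by (auto simp: offspring_def)
  ultimately show ?thesis
    using E by (simp add: lessThan_Suc_atMost[symmetric] prod.lessThan_Suc_shift
        measure_root_degree measure_subtree del: prod.lessThan_Suc)
qed

section \<open>Probability of reaching a set \<open>k\<close> generations below\<close>

primrec reach :: "nat \<Rightarrow> (nat list \<Rightarrow> nat) set \<Rightarrow> (nat list \<Rightarrow> nat) set" where
  "reach 0 E = E"
| "reach (Suc k) E = {N. \<exists>i<N []. subtree i N \<in> reach k E}"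

text \<open>Failure at every child, sorted by the exact number \<open>b\<close> of children: the
  events are disjoint in \<open>b\<close>, and \<open>measure_offspring\<close> gives each
  probability.\<close>

lemma reach_Suc_eq: "reach (Suc k) E = - (\<Union>b. offspring b (- reach k E))"
  by (auto simp: offspring_def)

lemma sets_reach:
  assumes "E \<in> sets (poisson_tree_space d)"
  shows "reach k E \<in> sets (poisson_tree_space d)"
proof (induction k)
  case (Suc k)
  have "- reach k E \<in> sets (poisson_tree_space d)"
    using sets.compl_sets[OF Suc] by (simp add: Compl_eq_Diff_UNIV)
  then have "(\<Union>b. offspring b (- reach k E)) \<in> sets (poisson_tree_space d)"
    by (auto intro: sets_offspring)
  from sets.compl_sets[OF this] show ?case
    unfolding reach_Suc_eq by (simp add: Compl_eq_Diff_UNIV)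
qed (use assms in simp)

text \<open>If \<open>r\<close> is the probability for \<open>k\<close>, failure for
  \<open>Suc k\<close> has as its probability the sum over \<open>b\<close> of
  \<open>exp (- d) * (d * (1 - r)) ^ b / fact b\<close>, the Poisson generating function at
  \<open>1 - r\<close>.\<close>

lemma measure_reach_Suc:
  assumes E: "E \<in> sets (poisson_tree_space d)" and "d > 0"
  shows "measure (poisson_tree_space d) (reach (Suc k) E) =
    1 - exp (- d * measure (poisson_tree_space d) (reach k E))"
proof -
  let ?P = "poisson_tree_space d"
  interpret prob_space ?P by (rule prob_space_poisson_tree_space)
  let ?r = "prob (reach k E)"
  have R: "reach k E \<in> events" by (rule sets_reach[OF E])
  then have nR: "- reach k E \<in> events"
    using sets.compl_sets[OF R] by (simp add: Compl_eq_Diff_UNIV)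
  have pn: "prob (- reach k E) = 1 - ?r"
    using prob_compl[OF R] by (simp add: Compl_eq_Diff_UNIV)
  have "(\<lambda>b. prob (offspring b (- reach k E))) sums prob (\<Union>b. offspring b (- reach k E))"
    by (rule finite_measure_UNION)
       (use nR in \<open>auto simp: disjoint_family_on_def sets_offspring, auto simp: offspring_def\<close>)
  moreover have "(\<lambda>b. prob (offspring b (- reach k E))) =
      (\<lambda>b. exp (- d) * ((d * (1 - ?r)) ^ b /\<^sub>R fact b))"
    using \<open>d > 0\<close>
    by (simp add: measure_offspring[OF nR] pn power_mult_distrib pmf_poisson divide_inverse mult_ac)
  moreover have "(\<lambda>b. exp (- d) * ((d * (1 - ?r)) ^ b /\<^sub>R fact b)) sums (exp (- d) * exp (d * (1 - ?r)))"
    by (intro sums_mult exp_converges)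
  ultimately have "prob (\<Union>b. offspring b (- reach k E)) = exp (- d) * exp (d * (1 - ?r))"
    by (simp add: sums_unique2)
  also have "\<dots> = exp (- d * ?r)"
    by (simp add: exp_add[symmetric] algebra_simps)
  finally have "prob (\<Union>b. offspring b (- reach k E)) = exp (- d * ?r)" .
  moreover have "(\<Union>b. offspring b (- reach k E)) \<in> events"
    using nR by (auto intro: sets_offspring)
  ultimately show ?thesis
    unfolding reach_Suc_eq using prob_compl by (simp add: Compl_eq_Diff_UNIV)
qed

section \<open>Trees branching for ever\<close>

lemma reach_mono: "E \<subseteq> F \<Longrightarrow> reach k E \<subseteq> reach k F"
  by (induction k) (fastforce simp: subset_iff)+

text \<open>Compactness: the root has finitely many children, so one of them works for infinitely
  many \<open>n\<close>, and by monotonicity of \<open>E\<close> for every \<open>n\<close>.\<close>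

lemma reach_INT:
  assumes "decseq E"
  shows "(\<Inter>n. reach k (E n)) \<subseteq> reach k (\<Inter>n. E n)"
proof (induction k)
  case (Suc k)
  show ?case
  proof
    fix N assume N: "N \<in> (\<Inter>n. reach (Suc k) (E n))"
    have "\<exists>i\<in>{..<N []}. \<exists>\<^sub>\<infinity>n. subtree i N \<in> reach k (E n)"
    proof -
      have "\<exists>\<^sub>\<infinity>n. \<exists>i\<in>{..<N []}. subtree i N \<in> reach k (E n)"
        unfolding INFM_nat_le using N by (auto simp: Bex_def)
      then show ?thesis by (subst (asm) INFM_finite_Bex_distrib) auto
    qed
    then obtain i where i: "i < N []" "\<exists>\<^sub>\<infinity>n. subtree i N \<in> reach k (E n)" by auto
    have "subtree i N \<in> reach k (E n)" for n
    proof -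
      obtain n' where "n' \<ge> n" "subtree i N \<in> reach k (E n')"
        using i(2) unfolding INFM_nat_le by blast
      moreover have "E n' \<subseteq> E n" using \<open>n' \<ge> n\<close> assms by (simp add: decseq_def)
      ultimately show ?thesis using reach_mono by blast
    qed
    then have "subtree i N \<in> reach k (\<Inter>n. E n)" using Suc by blast
    then show "N \<in> reach (Suc k) (\<Inter>n. E n)" using i(1) by auto
  qed
qed simp

text \<open>Branchings are \<open>k + 1\<close> generations apart: one generation leads to the two
  children, and \<open>k\<close> more to the next branching vertices.\<close>

primrec good :: "nat \<Rightarrow> nat \<Rightarrow> (nat list \<Rightarrow> nat) set" where
  "good k 0 = UNIV"
| "good k (Suc n) = offspring 2 (reach k (good k n))"

lemma sets_good: "good k n \<in> sets (poisson_tree_space d)"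
proof (induction n)
  case 0
  then show ?case using sets.top[of "poisson_tree_space d"] by simp
qed (simp add: sets_offspring sets_reach)

lemma decseq_good: "decseq (good k)"
proof (rule decseq_SucI)
  show "good k (Suc n) \<subseteq> good k n" for n
  proof (induction n)
    case (Suc n)
    then show ?case using reach_mono[OF Suc, of k] by (auto simp: offspring_def)
  qed simp
qed

definition branching :: "nat \<Rightarrow> (nat list \<Rightarrow> nat) set" where
  "branching k = (\<Inter>n. good k n)"

text \<open>By \<open>reach_INT\<close> the descendants that work for each \<open>n\<close> can be
  chosen independently of \<open>n\<close>. The inclusion allows the descent to be repeated for
  ever.\<close>

lemma branching_subset: "branching k \<subseteq> offspring 2 (reach k (branching k))"
proof
  fix N assume "N \<in> branching k"
  then have "N \<in> good k (Suc n)" for n unfolding branching_def by blast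
  then have "N [] = 2" "i < 2 \<Longrightarrow> subtree i N \<in> (\<Inter>n. reach k (good k n))" for i
    by (auto simp: offspring_def)
  then show "N \<in> offspring 2 (reach k (branching k))"
    using reach_INT[OF decseq_good, of k k] by (auto simp: offspring_def branching_def)
qed

text \<open>With \<open>t = d * x\<close>, \<open>1 - exp (- t)\<close> is at least
  \<open>t - t^2 / 2\<close>. The bound on \<open>x\<close> makes \<open>t^2 / 2\<close> at most
  \<open>(d - 1) * x / 2\<close>, which leaves \<open>(d + 1) / 2 * x\<close>.\<close>

lemma survival_growth:
  fixes d x :: real
  assumes d: "d > 1" and x: "0 \<le> x" "x \<le> (d - 1) / d\<^sup>2"
  shows "(d + 1) / 2 * x \<le> 1 - exp (- d * x)"
proof -
  let ?t = "d * x"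
  have "?t \<le> (d - 1) / d" using x d by (simp add: field_simps power2_eq_square)
  moreover have "(d - 1) / d \<le> 1" using d by simp
  ultimately have t: "0 \<le> ?t" "?t \<le> (d - 1) / d" "?t \<le> 1"
    using x d by (simp, simp, linarith)
  \<comment> \<open>The quadratic lower bound for \<open>exp ?t\<close> is inverted: the two
    quadratics have the product \<open>1 + ?t^4 / 4\<close>, which is at least 1.\<close>
  have "exp (- ?t) \<le> 1 - ?t + ?t\<^sup>2 / 2"
  proof -
    have "exp ?t \<ge> 1 + ?t + ?t\<^sup>2 / 2"
      using exp_lower_Taylor_quadratic[OF t(1)] by simp
    then have "exp (- ?t) \<le> inverse (1 + ?t + ?t\<^sup>2 / 2)"
      using t by (simp add: exp_minus le_imp_inverse_le add_pos_nonneg)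
    also have "\<dots> \<le> 1 - ?t + ?t\<^sup>2 / 2"
    proof -
      have "1 \<le> (1 - ?t + ?t\<^sup>2 / 2) * (1 + ?t + ?t\<^sup>2 / 2)"
      proof -
        have "(1 - ?t + ?t\<^sup>2 / 2) * (1 + ?t + ?t\<^sup>2 / 2) = 1 + (?t\<^sup>2)\<^sup>2 / 4"
          by (simp add: algebra_simps power2_eq_square)
        then show ?thesis by simp
      qed
      then show ?thesis using t by (simp add: inverse_eq_divide pos_divide_le_eq add_pos_nonneg)
    qed
    finally show ?thesis .
  qed
  moreover have "?t\<^sup>2 \<le> ?t * ((d - 1) / d)"
    unfolding power2_eq_square using t by (intro mult_left_mono)
  moreover have "?t * ((d - 1) / d) = (d - 1) * x" using d by simp
  ultimately have "exp (- ?t) \<le> 1 - ?t + (d - 1) * x / 2" by linarith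
  then show ?thesis by (simp add: algebra_simps add_divide_distrib diff_divide_distrib)
qed

text \<open>Each generation multiplies the bound by \<open>(d + 1) / 2\<close> until it meets the
  threshold of \<open>survival_growth\<close>, where the minimum freezes it.\<close>

lemma measure_reach_ge:
  fixes d :: real
  assumes d: "d > 1" and E: "E \<in> sets (poisson_tree_space d)"
  shows "measure (poisson_tree_space d) (reach k E) \<ge>
    min ((d - 1) / d\<^sup>2) (((d + 1) / 2) ^ k * measure (poisson_tree_space d) E)"
proof (induction k)
  case (Suc k)
  let ?s = "(d - 1) / d\<^sup>2" and ?\<rho> = "(d + 1) / 2"
  let ?r = "measure (poisson_tree_space d) (reach k E)"
  let ?x = "min ?s (?\<rho> ^ k * measure (poisson_tree_space d) E)"
  have s: "?s > 0" using d by simp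
  have x: "0 \<le> ?x" "?x \<le> ?s" "?x \<le> ?\<rho> ^ k * measure (poisson_tree_space d) E"
    using s d by (auto simp: min_def)
  \<comment> \<open>As \<open>?\<rho> > 1\<close>, the cap may be enlarged by the factor
    \<open>?\<rho>\<close>, which then comes out of the minimum.\<close>
  have "min ?s (?\<rho> ^ Suc k * measure (poisson_tree_space d) E)
      \<le> min (?\<rho> * ?s) (?\<rho> ^ Suc k * measure (poisson_tree_space d) E)"
    using s d mult_right_mono[of 1 ?\<rho> ?s] by (intro min.mono) auto
  also have "\<dots> = ?\<rho> * ?x"
    using d by (simp add: min_mult_distrib_left mult_ac)
  also have "\<dots> \<le> 1 - exp (- d * ?x)"
    by (rule survival_growth[OF d x(1,2)])
  also have "\<dots> \<le> 1 - exp (- d * ?r)"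
    using Suc d by simp
  finally show ?case using d by (simp only: measure_reach_Suc[OF E])
qed simp

text \<open>For large \<open>m\<close> the lower bound \<open>q\<close> on the probability of
  \<open>good (2 * m) n\<close> reproduces itself from \<open>n\<close> to \<open>Suc n\<close>;
  continuity from above carries it to the intersection.\<close>

lemma measure_branching_pos:
  fixes d :: real
  assumes d: "d > 1"
  obtains m where "measure (poisson_tree_space d) (branching (2 * m)) > 0"
proof -
  interpret prob_space "poisson_tree_space d" by (rule prob_space_poisson_tree_space)
  define s where "s = (d - 1) / d\<^sup>2"
  \<comment> \<open>The chance of exactly two children, both reaching the next good vertex, when
    each does so with the capped probability \<open>s\<close>.\<close>
  define q where "q = pmf (poisson_pmf d) 2 * s\<^sup>2"
  have "d - 1 \<le> d\<^sup>2" using d by (smt (verit) power2_eq_square mult_less_cancel_left2)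
  then have s: "0 < s" "s \<le> 1" using d by (auto simp: s_def)
  have q: "0 < q" "q \<le> 1"
  proof -
    have "pmf (poisson_pmf d) 2 * s\<^sup>2 \<le> 1 * 1"
      using s by (intro mult_mono pmf_le_1 power_le_one) auto
    then show "q \<le> 1" by (simp add: q_def)
  qed (use d s in \<open>simp add: q_def\<close>)
  obtain m where m: "((d + 1) / 2) ^ m > s / q"
    using real_arch_pow[of "(d + 1) / 2" "s / q"] d by auto
  \<comment> \<open>Doubling \<open>m\<close> only helps here, and it makes the period
    \<open>2 * m + 1\<close> odd, as the fugacity argument requires.\<close>
  have "((d + 1) / 2) ^ m \<le> ((d + 1) / 2) ^ (2 * m)"
    using d by (intro power_increasing) auto
  then have m': "((d + 1) / 2) ^ (2 * m) * q \<ge> s"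
    using m q by (simp add: divide_less_eq) (smt (verit) mult_right_mono)
  have ge: "prob (good (2 * m) n) \<ge> q" for n
  proof (induction n)
    case (Suc n)
    have "s \<le> ((d + 1) / 2) ^ (2 * m) * q" by (fact m')
    also have "\<dots> \<le> ((d + 1) / 2) ^ (2 * m) * prob (good (2 * m) n)"
      using Suc d by (intro mult_left_mono) auto
    finally have "s \<le> prob (reach (2 * m) (good (2 * m) n))"
      using measure_reach_ge[OF d sets_good, of "2 * m" "2 * m" n] by (simp add: s_def min_def split: if_splits)
    then have "s\<^sup>2 \<le> (prob (reach (2 * m) (good (2 * m) n)))\<^sup>2"
      using s by (intro power_mono) auto
    then show ?case
      by (auto simp: measure_offspring sets_reach sets_good q_def intro!: mult_left_mono)
  qed (use q prob_space in simp)
  have "(\<lambda>n. prob (good (2 * m) n)) \<longlonglongrightarrow> prob (\<Inter>n. good (2 * m) n)"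
    by (rule finite_Lim_measure_decseq) (auto simp: sets_good decseq_good)
  then have "q \<le> prob (branching (2 * m))"
    unfolding branching_def by (rule LIMSEQ_le_const) (use ge in auto)
  with q show thesis by (intro that[of m]) simp
qed

lemma sets_branching: "branching k \<in> sets (poisson_tree_space d)"
  unfolding branching_def by (auto intro: sets_good)

section \<open>Embedding the stretched tree\<close>

lemma Nil_in_tree_verts [simp]: "[] \<in> tree_verts N"
  by (rule tree_verts.root)

lemma Cons_in_tree_verts_iff:
  "i # v \<in> tree_verts N \<longleftrightarrow> i < N [] \<and> v \<in> tree_verts (subtree i N)"
proof (induction v rule: rev_induct)
  case Nil
  have "[] @ [i] \<in> tree_verts N \<longleftrightarrow> i < N []"
    using tree_verts.child[of "[]" N i] tree_verts_snocD[of "[]" i N] by auto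
  then show ?case by simp
next
  case (snoc j v)
  have iff: "w @ [j] \<in> tree_verts M \<longleftrightarrow> w \<in> tree_verts M \<and> j < M w" for w M
    by (auto elim: tree_verts.cases intro: tree_verts.child)
  show ?case
    using snoc iff[of "i # v" N] iff[of v "subtree i N"] by (auto simp: subtree_def)
qed

definition stretched_arity :: "nat \<Rightarrow> nat \<Rightarrow> nat" where
  "stretched_arity c j = (if c dvd j then 2 else 1)"

text \<open>Generations are counted from \<open>j\<close>, so that the family is closed under passing to the
  subtree at a child of the root.\<close>

definition stretched :: "nat \<Rightarrow> nat \<Rightarrow> nat list \<Rightarrow> nat" where
  "stretched c j = (\<lambda>v. stretched_arity c (j + length v))"

lemma stretched_Nil [simp]: "stretched c j [] = stretched_arity c j"
  by (simp add: stretched_def)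

lemma subtree_stretched [simp]: "subtree i (stretched c j) = stretched c (Suc j)"
  by (simp add: subtree_def stretched_def)

lemma stretched_binary_tree_eq: "stretched_binary_tree c = tree_graph (stretched c 0)"
  by (simp add: stretched_binary_tree_def stretched_def stretched_arity_def)

text \<open>The trees that can carry the part of the stretched tree below generation \<open>j\<close>.\<close>

definition carrier_trees :: "nat \<Rightarrow> nat \<Rightarrow> (nat list \<Rightarrow> nat) set" where
  "carrier_trees c j = (if c dvd j then branching (c - 1)
     else reach (c - j mod c) (branching (c - 1)))"

text \<open>The invariant of the embedding: both children are kept at a branching generation;
  elsewhere one child on the way to the next branching vertex is picked.\<close>

lemma carrier_trees_step:
  assumes "c \<ge> 1" "M \<in> carrier_trees c j"
  shows "\<exists>e. inj_on e {..<stretched_arity c j} \<and>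
    (\<forall>i<stretched_arity c j. e i < M [] \<and> subtree (e i) M \<in> carrier_trees c (Suc j))"
proof (cases "c dvd j")
  case True
  \<comment> \<open>For \<open>c = 1\<close> the next generation branches again, and
    \<open>reach 0\<close> is the identity.\<close>
  have "reach (c - 1) (branching (c - 1)) = carrier_trees c (Suc j)"
    using True assms(1) by (cases "c = 1") (auto simp: carrier_trees_def mod_Suc dvd_eq_mod_eq_0)
  moreover have "M \<in> offspring 2 (reach (c - 1) (branching (c - 1)))"
    using assms(2) True branching_subset by (auto simp: carrier_trees_def)
  ultimately show ?thesis
    using True by (intro exI[of _ id]) (auto simp: stretched_arity_def offspring_def)
next
  case False
  let ?k = "c - Suc (j mod c)"
  have lt: "j mod c < c" using assms(1) by simp
  then have "c - j mod c = Suc ?k" by simp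
  then have "M \<in> reach (Suc ?k) (branching (c - 1))"
    using assms(2) False by (simp add: carrier_trees_def)
  \<comment> \<open>If \<open>Suc (j mod c) = c\<close>, the next generation is a branching one;
    then \<open>?k = 0\<close> and both sides are \<open>branching (c - 1)\<close>.\<close>
  moreover have "reach ?k (branching (c - 1)) = carrier_trees c (Suc j)"
    by (auto simp: carrier_trees_def mod_Suc dvd_eq_mod_eq_0)
  ultimately obtain i where "i < M []" "subtree i M \<in> carrier_trees c (Suc j)"
    by auto
  then show ?thesis
    using False by (intro exI[of _ "\<lambda>_. i"]) (auto simp: stretched_arity_def inj_on_def)
qed

text \<open>A function of \<open>j\<close> and \<open>M\<close> alone, so that vertices with a
  common prefix are sent to vertices with a common prefix.\<close>

definition child_choice :: "nat \<Rightarrow> nat \<Rightarrow> (nat list \<Rightarrow> nat) \<Rightarrow> nat \<Rightarrow> nat" where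
  "child_choice c j M = (SOME e. inj_on e {..<stretched_arity c j} \<and>
    (\<forall>i<stretched_arity c j. e i < M [] \<and> subtree (e i) M \<in> carrier_trees c (Suc j)))"

lemma child_choice:
  assumes "c \<ge> 1" "M \<in> carrier_trees c j"
  shows "inj_on (child_choice c j M) {..<stretched_arity c j}"
    and "i < stretched_arity c j \<Longrightarrow> child_choice c j M i < M []"
    and "i < stretched_arity c j \<Longrightarrow> subtree (child_choice c j M i) M \<in> carrier_trees c (Suc j)"
  using someI_ex[OF carrier_trees_step[OF assms]] unfolding child_choice_def by blast+

primrec embed :: "nat \<Rightarrow> nat \<Rightarrow> (nat list \<Rightarrow> nat) \<Rightarrow> nat list \<Rightarrow> nat list" where
  "embed c j M [] = []"
| "embed c j M (i # v) = child_choice c j M i # embed c (Suc j) (subtree (child_choice c j M i) M) v"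

lemma length_embed [simp]: "length (embed c j M v) = length v"
  by (induction v arbitrary: j M) auto

text \<open>This is what sends edges to edges.\<close>

lemma embed_snoc: "\<exists>x. embed c j M (v @ [i]) = embed c j M v @ [x]"
  by (induction v arbitrary: j M) auto

lemma embed_in_tree_verts:
  assumes "c \<ge> 1" "M \<in> carrier_trees c j" "v \<in> tree_verts (stretched c j)"
  shows "embed c j M v \<in> tree_verts M"
  using assms(2,3)
  by (induction v arbitrary: j M) (auto simp: Cons_in_tree_verts_iff child_choice[OF assms(1)])

lemma inj_on_embed:
  assumes "c \<ge> 1" "M \<in> carrier_trees c j"
  shows "inj_on (embed c j M) (tree_verts (stretched c j))"
proof -
  have "v = w" if "M \<in> carrier_trees c j" "v \<in> tree_verts (stretched c j)"
    "w \<in> tree_verts (stretched c j)" "embed c j M v = embed c j M w" for v w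
    using that
  proof (induction v arbitrary: j M w)
    case Nil
    then show ?case by (cases w) auto
  next
    case (Cons i v)
    then obtain i' w' where w: "w = i' # w'" by (cases w) auto
    have "i = i'"
      using Cons.prems inj_onD[OF child_choice(1)[OF assms(1) Cons.prems(1)], of i i']
      by (auto simp: w Cons_in_tree_verts_iff)
    then show ?case
      using Cons.prems Cons.IH[OF child_choice(3)[OF assms(1) Cons.prems(1)]]
      by (auto simp: w Cons_in_tree_verts_iff)
  qed
  then show ?thesis using assms(2) by (auto intro: inj_onI)
qed

lemma stretched_subgraph_of_branching:
  assumes c: "c \<ge> 1" and N: "N \<in> branching (c - 1)"
  shows "\<exists>H. subgraph H (tree_graph N) \<and> graph_iso (stretched_binary_tree c) H"
proof -
  let ?G = "stretched_binary_tree c" and ?f = "embed c 0 N"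
  have N': "N \<in> carrier_trees c 0" using N by (simp add: carrier_trees_def)
  have inj: "inj_on ?f (verts ?G)"
    using inj_on_embed[OF c N'] by (simp add: stretched_binary_tree_eq tree_graph_def)
  have V: "?f ` verts ?G \<subseteq> verts (tree_graph N)"
    using embed_in_tree_verts[OF c N'] by (auto simp: stretched_binary_tree_eq tree_graph_def)
  have G: "simple_graph ?G"
    by (simp add: stretched_binary_tree_def simple_graph_tree_graph)
  \<comment> \<open>With the images of the edges as edges, the isomorphism follows from injectivity
    of \<open>?f\<close>; that they are edges of the tree follows from
    \<open>embed_snoc\<close>.\<close>
  define H where "H = \<lparr>verts = ?f ` verts ?G, adj = map_prod ?f ?f ` adj ?G\<rparr>"
  have iff: "(?f u, ?f v) \<in> adj H \<longleftrightarrow> (u, v) \<in> adj ?G" if "u \<in> verts ?G" "v \<in> verts ?G" for u v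
    
    using that G inj_on_image_mem_iff[OF map_prod_inj_on[OF inj inj], of "(u, v)" "adj ?G"]
    by (simp add: H_def simple_graph_def)
  have adj: "adj H \<subseteq> adj (tree_graph N)"
  proof
    fix e assume "e \<in> adj H"
    then obtain u v where e: "e = (?f u, ?f v)" "(u, v) \<in> adj ?G" by (auto simp: H_def)
    then have uv: "u \<in> verts ?G" "v \<in> verts ?G" "\<exists>i. v = u @ [i] \<or> u = v @ [i]"
      by (auto simp: stretched_binary_tree_def tree_graph_def)
    have "?f u \<in> tree_verts N" "?f v \<in> tree_verts N"
      using uv V by (auto simp: tree_graph_def)
    moreover have "\<exists>i. ?f v = ?f u @ [i] \<or> ?f u = ?f v @ [i]"
      using uv(3) embed_snoc[of c 0 N] by blast
    ultimately show "e \<in> adj (tree_graph N)"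
      by (simp add: tree_graph_def e(1))
  qed
  moreover have "simple_graph H"
    unfolding simple_graph_def
  proof (intro conjI)
    show "adj H \<subseteq> verts H \<times> verts H" using G by (auto simp: H_def simple_graph_def)
    show "sym (adj H)"
    proof (rule symI)
      fix a b assume "(a, b) \<in> adj H"
      then obtain u v where "a = ?f u" "b = ?f v" "(u, v) \<in> adj ?G" by (auto simp: H_def)
      moreover from this have "(v, u) \<in> adj ?G" using G by (simp add: simple_graph_def sym_def)
      ultimately show "(b, a) \<in> adj H" by (auto simp: H_def image_iff intro!: bexI[of _ "(v, u)"])
    qed
    show "irrefl (adj H)"
      using adj simple_graph_tree_graph[of N] by (auto simp: simple_graph_def irrefl_def)
  qed
  moreover have "verts H \<subseteq> verts (tree_graph N)" using V by (simp add: H_def)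
  moreover have "graph_iso ?G H"
    unfolding graph_iso_def using iff inj
    by (intro exI[of _ ?f]) (auto simp: bij_betw_def H_def)
  ultimately show ?thesis unfolding subgraph_def by blast
qed

section \<open>Invariance of weak spatial mixing under isomorphism\<close>

lemma total_variation_ge:
  "\<bar>measure_pmf.prob p A - measure_pmf.prob q A\<bar> \<le> total_variation p q"
  unfolding total_variation_def
proof (rule cSUP_upper)
  have "\<bar>measure_pmf.prob p B - measure_pmf.prob q B\<bar> \<le> 1" for B
    using measure_pmf.prob_le_1[of p B] measure_pmf.prob_le_1[of q B]
      measure_nonneg[of p B] measure_nonneg[of q B] by linarith
  then show "bdd_above (range (\<lambda>B. \<bar>measure_pmf.prob p B - measure_pmf.prob q B\<bar>))"
    by (intro bdd_aboveI[of _ 1]) auto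
qed simp

text \<open>Data processing: every event for the images is a preimage event for the
  originals.\<close>

lemma total_variation_map_le:
  "total_variation (map_pmf h p) (map_pmf h q) \<le> total_variation p q"
  unfolding total_variation_def [of "map_pmf h p"]
  by (rule cSUP_least) (auto simp: total_variation_ge)

lemma total_variation_nonneg: "0 \<le> total_variation p q"
  using total_variation_ge[of p "{}" q] by simp

lemma set_pmf_hardcore:
  assumes "fug > 0" "finite \<Psi>" "boundary_cond G \<Psi> \<sigma>"
  shows "set_pmf (hardcore fug G \<Psi> \<sigma>) = configs G \<Psi> \<sigma>"
proof -
  have fin: "finite (configs G \<Psi> \<sigma>)"
    using assms(2) by (auto intro: finite_subset[of _ "Pow \<Psi>"] simp: configs_def)
  have pos: "(\<Sum>T\<in>configs G \<Psi> \<sigma>. fug ^ card T) > 0" if "S \<in> configs G \<Psi> \<sigma>" for S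
    using fin assms(1) that by (intro sum_pos) auto
  show ?thesis
    using pos assms(1)
    by (auto simp: set_pmf_iff pmf_hardcore[OF assms] dest: less_imp_neq split: if_splits)
qed

lemma boundary_subset: "boundary K \<Psi> \<subseteq> \<Psi>"
  by (auto simp: boundary_def)

context
  fixes G :: "'v ugraph" and H :: "'w ugraph" and f :: "'v \<Rightarrow> 'w"
  assumes G: "simple_graph G" and H: "simple_graph H"
    and bij: "bij_betw f (verts G) (verts H)"
    and adj_iff: "\<And>u v. u \<in> verts G \<Longrightarrow> v \<in> verts G \<Longrightarrow> (u, v) \<in> adj G \<longleftrightarrow> (f u, f v) \<in> adj H"
begin

lemma iso_vertex_imageE:
  assumes "w \<in> verts H"
  obtains v where "v \<in> verts G" "w = f v"
  using assms bij by (auto simp: bij_betw_def)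

lemma iso_eq_iff: "u \<in> verts G \<Longrightarrow> v \<in> verts G \<Longrightarrow> f u = f v \<longleftrightarrow> u = v"
  using bij by (auto simp: bij_betw_def inj_on_def)

lemma iso_inj_on_image: "inj_on ((`) f) (Pow (verts G))"
  using bij by (auto simp: bij_betw_def intro: inj_on_image_Pow)

lemma iso_boundary:
  assumes "\<Psi> \<subseteq> verts G"
  shows "boundary H (f ` \<Psi>) = f ` boundary G \<Psi>"
proof -
  have "f v \<in> boundary H (f ` \<Psi>) \<longleftrightarrow> v \<in> boundary G \<Psi>" if "v \<in> \<Psi>" for v
  proof
    assume "f v \<in> boundary H (f ` \<Psi>)"
    then obtain w where w: "(f v, w) \<in> adj H" "w \<notin> f ` \<Psi>" by (auto simp: boundary_def)
    then have "w \<in> verts H" using H by (auto simp: simple_graph_def)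
    then obtain u where "u \<in> verts G" "w = f u" by (rule iso_vertex_imageE)
    then have "(v, u) \<in> adj G" "u \<notin> \<Psi>" using w that assms by (auto simp: adj_iff)
    then show "v \<in> boundary G \<Psi>" using that by (auto simp: boundary_def)
  next
    assume "v \<in> boundary G \<Psi>"
    then obtain u where u: "(v, u) \<in> adj G" "u \<notin> \<Psi>" by (auto simp: boundary_def)
    then have "u \<in> verts G" using G by (auto simp: simple_graph_def)
    then have "(f v, f u) \<in> adj H" "f u \<notin> f ` \<Psi>"
      using u that assms by (auto simp: adj_iff iso_eq_iff subset_iff)
    then show "f v \<in> boundary H (f ` \<Psi>)" using that by (auto simp: boundary_def)
  qed
  then show ?thesis
    using boundary_subset[of G \<Psi>] boundary_subset[of H "f ` \<Psi>"] by blast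
qed

lemma iso_indep: "S \<subseteq> verts G \<Longrightarrow> indep H (f ` S) \<longleftrightarrow> indep G S"
  using bij by (auto simp: indep_def adj_iff subset_iff bij_betw_def)

lemma iso_boundary_cond:
  assumes "\<Psi> \<subseteq> verts G" "boundary_cond G \<Psi> \<sigma>"
  shows "boundary_cond H (f ` \<Psi>) (f ` \<sigma>)"
proof -
  have "\<sigma> \<subseteq> verts G"
    using assms boundary_subset[of G \<Psi>] by (auto simp: boundary_cond_def)
  then show ?thesis
    using assms by (simp add: boundary_cond_def iso_boundary iso_indep image_mono)
qed

lemma iso_configs:
  assumes "\<Psi> \<subseteq> verts G" "\<sigma> \<subseteq> boundary G \<Psi>"
  shows "configs H (f ` \<Psi>) (f ` \<sigma>) = (`) f ` configs G \<Psi> \<sigma>"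
proof -
  have eq: "f ` S \<in> configs H (f ` \<Psi>) (f ` \<sigma>) \<longleftrightarrow> S \<in> configs G \<Psi> \<sigma>" if S: "S \<subseteq> \<Psi>" for S
  proof -
    have inj: "inj_on f (verts G)" using bij by (simp add: bij_betw_def)
    have sub: "S \<subseteq> verts G" "boundary G \<Psi> \<subseteq> verts G" "\<sigma> \<subseteq> verts G"
      using S assms boundary_subset[of G \<Psi>] by auto
    have "f ` S \<inter> boundary H (f ` \<Psi>) = f ` (S \<inter> boundary G \<Psi>)"
      by (simp add: iso_boundary assms(1) inj_on_image_Int[OF inj sub(1,2)])
    then show ?thesis
      using S sub inj_on_image_eq_iff[OF inj, of "S \<inter> boundary G \<Psi>" \<sigma>]
      by (auto simp: configs_def iso_indep)
  qed
  have "T \<in> (`) f ` configs G \<Psi> \<sigma>" if "T \<in> configs H (f ` \<Psi>) (f ` \<sigma>)" for T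
  proof -
    have "T \<subseteq> f ` \<Psi>" using that by (simp add: configs_def)
    then obtain S where "S \<subseteq> \<Psi>" "T = f ` S" by (auto simp: subset_image_iff)
    then show ?thesis using eq that by auto
  qed
  moreover have "f ` S \<in> configs H (f ` \<Psi>) (f ` \<sigma>)" if "S \<in> configs G \<Psi> \<sigma>" for S
    using that eq[of S] by (simp add: configs_def)
  ultimately show ?thesis by (intro subset_antisym subsetI) auto
qed

lemma iso_hardcore:
  assumes fug: "fug > 0" and \<Psi>: "finite \<Psi>" "\<Psi> \<subseteq> verts G" and \<sigma>: "boundary_cond G \<Psi> \<sigma>"
  shows "hardcore fug H (f ` \<Psi>) (f ` \<sigma>) = map_pmf ((`) f) (hardcore fug G \<Psi> \<sigma>)"
proof (rule pmf_eqI)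
  fix T
  let ?C = "configs G \<Psi> \<sigma>"
  have C: "?C \<subseteq> Pow (verts G)" using \<Psi> by (auto simp: configs_def)
  then have inj: "inj_on ((`) f) ?C" by (rule inj_on_subset[OF iso_inj_on_image])
  have conf: "configs H (f ` \<Psi>) (f ` \<sigma>) = (`) f ` ?C"
    using \<sigma> by (intro iso_configs \<Psi>) (simp add: boundary_cond_def)
  have card: "card (f ` S) = card S" if "S \<in> ?C" for S
    using that C bij by (intro card_image) (auto simp: bij_betw_def intro: inj_on_subset)
  have set: "set_pmf (hardcore fug G \<Psi> \<sigma>) = ?C"
    by (rule set_pmf_hardcore[OF fug \<Psi>(1) \<sigma>])
  note pH = pmf_hardcore[OF fug finite_imageI[OF \<Psi>(1)] iso_boundary_cond[OF \<Psi>(2) \<sigma>]]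
  have Z: "(\<Sum>S\<in>(`) f ` ?C. fug ^ card S) = (\<Sum>S\<in>?C. fug ^ card S)"
    by (simp add: sum.reindex[OF inj] card)
  show "pmf (hardcore fug H (f ` \<Psi>) (f ` \<sigma>)) T = pmf (map_pmf ((`) f) (hardcore fug G \<Psi> \<sigma>)) T"
  proof (cases "T \<in> (`) f ` ?C")
    case True
    then obtain S where S: "S \<in> ?C" "T = f ` S" by blast
    then show ?thesis
      using inj set
      by (simp add: pH conf Z card pmf_map_inj pmf_hardcore[OF fug \<Psi>(1) \<sigma>])
  next
    case False
    then show ?thesis by (simp add: pH conf pmf_map_outside set)
  qed
qed

section \<open>Distances and marginals under an isomorphism\<close>

lemma iso_relpow:
  assumes "u \<in> verts G" "v \<in> verts G" "(f u, f v) \<in> adj H ^^ n"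
  shows "(u, v) \<in> adj G ^^ n"
  using assms(2,3)
proof (induction n arbitrary: v)
  case 0
  then show ?case using assms(1) by (simp add: iso_eq_iff)
next
  case (Suc n)
  then obtain w where w: "(f u, w) \<in> adj H ^^ n" "(w, f v) \<in> adj H" by auto
  then have "w \<in> verts H" using H by (auto simp: simple_graph_def)
  then obtain x where x: "x \<in> verts G" "w = f x" by (rule iso_vertex_imageE)
  then have "(u, x) \<in> adj G ^^ n" "(x, v) \<in> adj G" using Suc w by (simp_all add: adj_iff)
  then show ?case by auto
qed

text \<open>Walks in \<open>H\<close> between images pull back to \<open>G\<close>. This direction
  carries divergence of distances from \<open>G\<close> to \<open>H\<close>.\<close>

lemma iso_set_dist:
  assumes "A \<subseteq> verts G" "B \<subseteq> verts G"
  shows "set_dist G A B \<le> set_dist H (f ` A) (f ` B)"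
proof -
  have "gdist G u v \<le> gdist H (f u) (f v)" if "u \<in> A" "v \<in> B" for u v
    unfolding gdist_def using that assms by (intro INF_superset_mono) (auto intro: iso_relpow)
  then show ?thesis
    unfolding set_dist_def by (auto simp: image_image intro!: INF_mono)
qed

text \<open>The inverse of \<open>f\<close> recovers the marginal in \<open>G\<close> from the one
  in \<open>H\<close>, so data processing applies. The support conditions keep the inverse
  meaningful.\<close>

lemma iso_marginal_dist:
  assumes "\<Lambda> \<subseteq> verts G" "set_pmf p \<subseteq> Pow (verts G)" "set_pmf q \<subseteq> Pow (verts G)"
  shows "marginal_dist \<Lambda> p q \<le> marginal_dist (f ` \<Lambda>) (map_pmf ((`) f) p) (map_pmf ((`) f) q)"
proof -
  let ?g = "\<lambda>T. inv_into (verts G) f ` T"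
  have *: "map_pmf (\<lambda>S. S \<inter> \<Lambda>) r = map_pmf ?g (map_pmf (\<lambda>T. T \<inter> f ` \<Lambda>) (map_pmf ((`) f) r))"
    if "set_pmf r \<subseteq> Pow (verts G)" for r
  proof -
    have inj: "inj_on f (verts G)" using bij by (simp add: bij_betw_def)
    have "?g (f ` S \<inter> f ` \<Lambda>) = S \<inter> \<Lambda>" if "S \<subseteq> verts G" for S
    proof -
      have "f ` S \<inter> f ` \<Lambda> = f ` (S \<inter> \<Lambda>)"
        by (rule inj_on_image_Int[OF inj that assms(1), symmetric])
      then show ?thesis
        using inv_into_image_cancel[OF inj, of "S \<inter> \<Lambda>"] that by auto
    qed
    then show ?thesis
      using that by (auto simp: pmf.map_comp o_def intro!: map_pmf_cong)
  qed
  show ?thesis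
    unfolding marginal_dist_def by (simp only: *[OF assms(2)] *[OF assms(3)] total_variation_map_le)
qed

text \<open>Boundary conditions are transported along \<open>f\<close>. This is needed because the
  Poisson tree contains the stretched tree only up to isomorphism.\<close>

lemma iso_WSM:
  assumes fug: "fug > 0" and WSM: "WSM fug H"
  shows "WSM fug G"
  unfolding WSM_def
proof (intro allI impI)
  fix \<Lambda> \<Psi> \<sigma> \<tau>
  assume \<Lambda>: "finite \<Lambda>" "\<Lambda> \<subseteq> verts G"
    and all: "\<forall>n. finite (\<Psi> n) \<and> \<Lambda> \<subseteq> \<Psi> n \<and> \<Psi> n \<subseteq> verts G \<and>
      boundary_cond G (\<Psi> n) (\<sigma> n) \<and> boundary_cond G (\<Psi> n) (\<tau> n)"
    and lim: "(\<lambda>n. set_dist G \<Lambda> (boundary G (\<Psi> n))) \<longlonglongrightarrow> \<infinity>"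
  have \<Psi>: "finite (\<Psi> n)" "\<Lambda> \<subseteq> \<Psi> n" "\<Psi> n \<subseteq> verts G"
    and bc: "boundary_cond G (\<Psi> n) (\<sigma> n)" "boundary_cond G (\<Psi> n) (\<tau> n)" for n
    using all by auto
  have supp: "set_pmf (hardcore fug G (\<Psi> n) \<upsilon>) \<subseteq> Pow (verts G)"
    if "boundary_cond G (\<Psi> n) \<upsilon>" for n \<upsilon>
    using set_pmf_hardcore[OF fug \<Psi>(1) that] \<Psi>(3)[of n] by (auto simp: configs_def)
  have "(\<lambda>n. set_dist H (f ` \<Lambda>) (boundary H (f ` \<Psi> n))) \<longlonglongrightarrow> \<infinity>"
  proof (rule tendsto_sandwich[OF _ _ lim tendsto_const])
    show "\<forall>\<^sub>F n in sequentially. set_dist G \<Lambda> (boundary G (\<Psi> n))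
        \<le> set_dist H (f ` \<Lambda>) (boundary H (f ` \<Psi> n))"
      using \<Lambda> subset_trans[OF boundary_subset \<Psi>(3)]
      by (intro always_eventually allI) (simp add: iso_boundary \<Psi>(3) iso_set_dist)
  qed simp
  moreover have "f ` A \<subseteq> verts H" if "A \<subseteq> verts G" for A
    using that bij by (auto simp: bij_betw_def)
  ultimately have *: "(\<lambda>n. marginal_dist (f ` \<Lambda>) (hardcore fug H (f ` \<Psi> n) (f ` \<sigma> n))
      (hardcore fug H (f ` \<Psi> n) (f ` \<tau> n))) \<longlonglongrightarrow> 0"
    using WSM[unfolded WSM_def, rule_format, of "f ` \<Lambda>" "\<lambda>n. f ` \<Psi> n" "\<lambda>n. f ` \<sigma> n" "\<lambda>n. f ` \<tau> n"]
      \<Lambda> \<Psi> bc iso_boundary_cond by (simp add: image_mono)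
  show "(\<lambda>n. marginal_dist \<Lambda> (hardcore fug G (\<Psi> n) (\<sigma> n)) (hardcore fug G (\<Psi> n) (\<tau> n))) \<longlonglongrightarrow> 0"
  proof (rule tendsto_sandwich[OF _ _ tendsto_const *])
    show "\<forall>\<^sub>F n in sequentially. marginal_dist \<Lambda> (hardcore fug G (\<Psi> n) (\<sigma> n)) (hardcore fug G (\<Psi> n) (\<tau> n))
      \<le> marginal_dist (f ` \<Lambda>) (hardcore fug H (f ` \<Psi> n) (f ` \<sigma> n)) (hardcore fug H (f ` \<Psi> n) (f ` \<tau> n))"
      by (intro always_eventually allI)
         (simp add: iso_hardcore fug \<Psi> bc iso_marginal_dist \<Lambda> supp)
  qed (simp add: marginal_dist_def total_variation_nonneg)
qed

end

lemma WSM_graph_iso: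
  assumes "graph_iso G H" "simple_graph G" "simple_graph H" "fug > 0" "WSM fug H"
  shows "WSM fug G"
proof -
  obtain f where "bij_betw f (verts G) (verts H) \<and>
      (\<forall>u\<in>verts G. \<forall>v\<in>verts G. (u, v) \<in> adj G \<longleftrightarrow> (f u, f v) \<in> adj H)"
    using assms(1) unfolding graph_iso_def ..
  then show ?thesis
    by (intro iso_WSM[OF assms(2,3) _ _ assms(4,5), of f]) simp_all
qed

section \<open>The hard-core model on a truncated tree\<close>

definition tree_ball :: "nat \<Rightarrow> (nat list \<Rightarrow> nat) \<Rightarrow> nat list set" where
  "tree_ball D N = {v \<in> tree_verts N. length v \<le> D}"

definition tree_level :: "nat \<Rightarrow> (nat list \<Rightarrow> nat) \<Rightarrow> nat list set" where
  "tree_level D N = {v \<in> tree_verts N. length v = D}"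

text \<open>\<open>s\<close> selects the boundary condition: level \<open>D\<close> fully occupied
  or empty. Independence is put in terms of parent and child, which suits recursion over the root's
  children.\<close>

definition level_configs :: "bool \<Rightarrow> nat \<Rightarrow> (nat list \<Rightarrow> nat) \<Rightarrow> nat list set set" where
  "level_configs s D N = {S. S \<subseteq> tree_ball D N \<and> (\<forall>u i. u \<in> S \<longrightarrow> u @ [i] \<notin> S) \<and>
     (\<forall>v\<in>tree_level D N. v \<in> S \<longleftrightarrow> s)}"

lemma tree_ball_0 [simp]: "tree_ball 0 N = {[]}"
  by (auto simp: tree_ball_def)

lemma tree_ball_Suc:
  "tree_ball (Suc D) N = insert [] (\<Union>i<N []. Cons i ` tree_ball D (subtree i N))"
proof -
  have "v \<in> tree_ball (Suc D) N \<longleftrightarrow> v \<in> insert [] (\<Union>i<N []. Cons i ` tree_ball D (subtree i N))" for v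
    by (cases v) (auto simp: tree_ball_def Cons_in_tree_verts_iff)
  then show ?thesis by blast
qed

lemma finite_tree_ball: "finite (tree_ball D N)"
  by (induction D arbitrary: N) (auto simp: tree_ball_Suc)

lemma finite_level_configs: "finite (level_configs s D N)"
  by (rule finite_subset[of _ "Pow (tree_ball D N)"])
     (auto simp: level_configs_def finite_tree_ball)

lemma finite_level_config: "S \<in> level_configs s D N \<Longrightarrow> finite S"
  by (auto simp: level_configs_def intro: finite_subset[OF _ finite_tree_ball])

lemma all_list_iff: "(\<forall>v. P v) \<longleftrightarrow> P [] \<and> (\<forall>i w. P (i # w))"
  by (metis list.exhaust)

text \<open>The branches interact only through the root, which is itself unconstrained by the
  boundary because level \<open>Suc D\<close> does not contain it.\<close>

lemma level_configs_Suc_iff: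
  "S \<in> level_configs s (Suc D) N \<longleftrightarrow>
     (\<forall>i w. i # w \<in> S \<longrightarrow> i < N []) \<and>
     (\<forall>i<N []. {w. i # w \<in> S} \<in> level_configs s D (subtree i N) \<and> ([] \<in> S \<longrightarrow> [i] \<notin> S))"
proof -
  have sub: "S \<subseteq> tree_ball (Suc D) N \<longleftrightarrow> (\<forall>i w. i # w \<in> S \<longrightarrow> i < N []) \<and>
      (\<forall>i<N []. {w. i # w \<in> S} \<subseteq> tree_ball D (subtree i N))"
    unfolding subset_iff all_list_iff[of "\<lambda>v. v \<in> S \<longrightarrow> v \<in> tree_ball (Suc D) N"]
    by (auto simp: tree_ball_def Cons_in_tree_verts_iff)
  have ind: "(\<forall>u i. u \<in> S \<longrightarrow> u @ [i] \<notin> S) \<longleftrightarrow>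
      (\<forall>i. [] \<in> S \<longrightarrow> [i] \<notin> S) \<and> (\<forall>i u j. i # u \<in> S \<longrightarrow> i # u @ [j] \<notin> S)"
    by (subst all_list_iff) auto
  have lev: "(\<forall>v\<in>tree_level (Suc D) N. v \<in> S \<longleftrightarrow> s) \<longleftrightarrow>
      (\<forall>i<N []. \<forall>w\<in>tree_level D (subtree i N). i # w \<in> S \<longleftrightarrow> s)"
    unfolding Ball_def by (subst all_list_iff) (auto simp: tree_level_def Cons_in_tree_verts_iff)
  show ?thesis
    unfolding level_configs_def mem_Collect_eq sub ind lev by blast
qed

definition partition_fun :: "real \<Rightarrow> bool \<Rightarrow> nat \<Rightarrow> (nat list \<Rightarrow> nat) \<Rightarrow> bool \<Rightarrow> real" where
  "partition_fun fug s D N r = (\<Sum>S\<in>{S \<in> level_configs s D N. ([] \<in> S) = r}. fug ^ card S)"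

text \<open>Once the state of the root is fixed, a configuration is an arbitrary tuple of branch
  configurations, and a sum over tuples of a product factorises. An occupied root forbids occupied
  children; an unoccupied one forbids nothing.\<close>

lemma partition_fun_Suc:
  "partition_fun fug s (Suc D) N r =
    fug ^ of_bool r * (\<Prod>i<N []. \<Sum>S\<in>{S \<in> level_configs s D (subtree i N). r \<longrightarrow> [] \<notin> S}. fug ^ card S)"
proof -
  let ?B = "\<lambda>i. {S \<in> level_configs s D (subtree i N). r \<longrightarrow> [] \<notin> S}"
  let ?join = "\<lambda>F. {v. case v of [] \<Rightarrow> r | i # w \<Rightarrow> i < N [] \<and> w \<in> F i}"
  have part: "i < N [] \<Longrightarrow> {w. i # w \<in> ?join F} = F i" for i F
    by auto
  have join_eq: "?join F = {v. v = [] \<and> r} \<union> (\<Union>i<N []. Cons i ` F i)" for F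
  proof (rule set_eqI)
    show "v \<in> ?join F \<longleftrightarrow> v \<in> {v. v = [] \<and> r} \<union> (\<Union>i<N []. Cons i ` F i)" for v
      by (cases v) auto
  qed
  have card: "card (?join F) = of_bool r + (\<Sum>i<N []. card (F i))"
    if "F \<in> (\<Pi>\<^sub>E i\<in>{..<N []}. ?B i)" for F
  proof -
    have fin: "finite (F i)" if "i < N []" for i
      using that \<open>F \<in> _\<close> by (auto simp: PiE_iff intro: finite_level_config)
    have "card (\<Union>i<N []. Cons i ` F i) = (\<Sum>i<N []. card (F i))"
      using fin by (subst card_UN_disjoint) (auto simp: card_image)
    moreover have "finite (\<Union>i<N []. Cons i ` F i)" using fin by auto
    ultimately show ?thesis
      unfolding join_eq by (subst card_Un_disjoint) (auto simp: Collect_conv_if)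
  qed
  have "partition_fun fug s (Suc D) N r =
      (\<Sum>F\<in>(\<Pi>\<^sub>E i\<in>{..<N []}. ?B i). fug ^ (of_bool r + (\<Sum>i<N []. card (F i))))"
    unfolding partition_fun_def
  \<comment> \<open>Cutting at the root and gluing by \<open>?join\<close> are mutually
    inverse.\<close>
  proof (rule sum.reindex_bij_witness[where i = ?join and j = "\<lambda>S. \<lambda>i\<in>{..<N []}. {w. i # w \<in> S}"])
    fix S assume S: "S \<in> {S \<in> level_configs s (Suc D) N. ([] \<in> S) = r}"
    show j: "(\<lambda>i\<in>{..<N []}. {w. i # w \<in> S}) \<in> (\<Pi>\<^sub>E i\<in>{..<N []}. ?B i)"
      using S by (auto simp: level_configs_Suc_iff)
    have "v \<in> ?join (\<lambda>i\<in>{..<N []}. {w. i # w \<in> S}) \<longleftrightarrow> v \<in> S" for v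
      using S by (cases v) (auto simp: level_configs_Suc_iff)
    then show eq: "?join (\<lambda>i\<in>{..<N []}. {w. i # w \<in> S}) = S" by blast
    show "fug ^ (of_bool r + (\<Sum>i<N []. card ((\<lambda>i\<in>{..<N []}. {w. i # w \<in> S}) i))) = fug ^ card S"
      using card[OF j] by (simp only: eq)
  next
    fix F assume F: "F \<in> (\<Pi>\<^sub>E i\<in>{..<N []}. ?B i)"
    show "?join F \<in> {S \<in> level_configs s (Suc D) N. ([] \<in> S) = r}"
      unfolding mem_Collect_eq[of _ "\<lambda>S. S \<in> level_configs s (Suc D) N \<and> ([] \<in> S) = r"] level_configs_Suc_iff
      using F by (auto simp: PiE_iff)
    show "(\<lambda>i\<in>{..<N []}. {w. i # w \<in> ?join F}) = F"
      using F by (intro extensionalityI[of _ "{..<N []}"]) (auto simp: PiE_iff)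
  qed
  also have "\<dots> = fug ^ of_bool r * (\<Sum>F\<in>(\<Pi>\<^sub>E i\<in>{..<N []}. ?B i). \<Prod>i<N []. fug ^ card (F i))"
    by (simp add: power_add power_sum sum_distrib_left)
  also have "(\<Sum>F\<in>(\<Pi>\<^sub>E i\<in>{..<N []}. ?B i). \<Prod>i<N []. fug ^ card (F i)) =
      (\<Prod>i<N []. \<Sum>S\<in>?B i. fug ^ card S)"
    by (rule prod_sum_PiE[symmetric]) (auto simp: finite_level_configs)
  finally show ?thesis .
qed

lemma sum_level_configs:
  "(\<Sum>S\<in>level_configs s D N. fug ^ card S) = partition_fun fug s D N False + partition_fun fug s D N True"
proof -
  have "level_configs s D N = {S \<in> level_configs s D N. ([] \<in> S) = False} \<union> {S \<in> level_configs s D N. ([] \<in> S) = True}"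
    by auto
  then show ?thesis
    unfolding partition_fun_def
    by (subst sum.union_disjoint[symmetric]) (auto simp: finite_level_configs)
qed

lemma partition_fun_unocc_Suc:
  "partition_fun fug s (Suc D) N False = 
    (\<Prod>i<N []. partition_fun fug s D (subtree i N) False + partition_fun fug s D (subtree i N) True)"
  by (simp add: partition_fun_Suc sum_level_configs)

lemma partition_fun_occ_Suc:
  "partition_fun fug s (Suc D) N True = fug * (\<Prod>i<N []. partition_fun fug s D (subtree i N) False)"
  by (simp add: partition_fun_Suc) (simp add: partition_fun_def)

lemma level_configs_0: "level_configs s 0 N = {if s then {[]} else {}}"
  by (auto simp: level_configs_def tree_level_def)

lemma partition_fun_0:
  "partition_fun fug s 0 N r = (if r = s then if s then fug else 1 else 0)"
proof -
  have "{S \<in> level_configs s 0 N. ([] \<in> S) = r} = (if r = s then {if s then {[]} else {}} else {})"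
    by (auto simp: level_configs_0)
  then show ?thesis by (simp add: partition_fun_def)
qed

lemma partition_fun_nonneg: "fug \<ge> 0 \<Longrightarrow> partition_fun fug s D N r \<ge> 0"
  by (simp add: partition_fun_def sum_nonneg)

text \<open>The sum is taken because at depth 0 one of the two weights vanishes; from depth 1 on the
  unoccupied weight alone is positive.\<close>

lemma partition_fun_pos:
  assumes "fug > 0"
  shows "partition_fun fug s D N False + partition_fun fug s D N True > 0"
proof (induction D arbitrary: N)
  case 0
  then show ?case using assms by (simp add: partition_fun_0)
next
  case (Suc D)
  have "partition_fun fug s (Suc D) N False > 0"
    unfolding partition_fun_unocc_Suc using Suc by (intro prod_pos) simp
  moreover have "partition_fun fug s (Suc D) N True \<ge> 0"
    using assms by (intro partition_fun_nonneg) simp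
  ultimately show ?case by simp
qed

section \<open>Recursion for the probability of an unoccupied root\<close>

definition root_unocc :: "real \<Rightarrow> bool \<Rightarrow> nat \<Rightarrow> (nat list \<Rightarrow> nat) \<Rightarrow> real" where
  "root_unocc fug s D N = partition_fun fug s D N False /
     (partition_fun fug s D N False + partition_fun fug s D N True)"

lemma root_unocc_0: "fug > 0 \<Longrightarrow> root_unocc fug s 0 N = (if s then 0 else 1)"
  by (simp add: root_unocc_def partition_fun_0)

text \<open>Dividing by the product of the total branch weights turns the two weight recursions into
  one for their normalised ratio.\<close>

lemma root_unocc_Suc:
  assumes "fug > 0"
  shows "root_unocc fug s (Suc D) N = 1 / (1 + fug * (\<Prod>i<N []. root_unocc fug s D (subtree i N)))"
proof -
  let ?T = "\<Prod>i<N []. partition_fun fug s D (subtree i N) False + partition_fun fug s D (subtree i N) True"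
  have T: "?T > 0" using partition_fun_pos[OF assms] by (intro prod_pos) simp
  have "1 + fug * (\<Prod>i<N []. root_unocc fug s D (subtree i N)) =
      (?T + fug * (\<Prod>i<N []. partition_fun fug s D (subtree i N) False)) / ?T"
    using T by (simp add: root_unocc_def prod_dividef add_divide_distrib del: prod_zero_iff prod_pos_nat_iff)
  then show ?thesis
    by (simp add: root_unocc_def partition_fun_unocc_Suc partition_fun_occ_Suc)
qed

text \<open>Every vertex has a child, so each vertex of level \<open>D\<close> has a neighbour
  outside the ball; a leaf there would not be a boundary vertex.\<close>

lemma boundary_tree_ball:
  assumes "\<And>v. N v \<ge> 1"
  shows "boundary (tree_graph N) (tree_ball D N) = tree_level D N"
proof
  show "boundary (tree_graph N) (tree_ball D N) \<subseteq> tree_level D N"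
    by (auto simp: boundary_def tree_graph_def tree_ball_def tree_level_def)
  show "tree_level D N \<subseteq> boundary (tree_graph N) (tree_ball D N)"
  proof
    fix v assume v: "v \<in> tree_level D N"
    then have "v @ [0] \<in> tree_verts N"
      using assms[of v] by (auto simp: tree_level_def intro!: tree_verts.child)
    then show "v \<in> boundary (tree_graph N) (tree_ball D N)"
      using v by (auto simp: boundary_def tree_graph_def tree_ball_def tree_level_def
          intro!: exI[of _ "v @ [0]"])
  qed
qed

lemma indep_tree_graph_iff:
  "indep (tree_graph N) S \<longleftrightarrow> S \<subseteq> tree_verts N \<and> (\<forall>u i. u \<in> S \<longrightarrow> u @ [i] \<notin> S)"
  by (auto simp: indep_def tree_graph_def)

lemma configs_tree_ball:
  assumes "\<And>v. N v \<ge> 1"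
  shows "configs (tree_graph N) (tree_ball D N) (if s then tree_level D N else {}) = level_configs s D N"
  unfolding configs_def level_configs_def boundary_tree_ball[OF assms] indep_tree_graph_iff
  by (cases s) (auto simp: tree_ball_def)

lemma boundary_cond_tree_ball:
  assumes "\<And>v. N v \<ge> 1"
  shows "boundary_cond (tree_graph N) (tree_ball D N) (if s then tree_level D N else {})"
  by (auto simp: boundary_cond_def boundary_tree_ball[OF assms] indep_tree_graph_iff tree_level_def)

lemma prob_root_unocc:
  assumes fug: "fug > 0" and N: "\<And>v. N v \<ge> 1"
  shows "measure_pmf.prob (map_pmf (\<lambda>S. S \<inter> {[]}) (hardcore fug (tree_graph N) (tree_ball D N)
     (if s then tree_level D N else {}))) {{}} = root_unocc fug s D N"
proof -
  let ?\<sigma> = "if s then tree_level D N else {}"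
  let ?p = "hardcore fug (tree_graph N) (tree_ball D N) ?\<sigma>"
  note bc = boundary_cond_tree_ball[of N D s, OF N]
  note conf = configs_tree_ball[of N D s, OF N]
  have vim: "(\<lambda>S. S \<inter> {[]}) -` {{}} \<inter> set_pmf ?p = {S \<in> level_configs s D N. ([] \<in> S) = False}"
    unfolding set_pmf_hardcore[OF fug finite_tree_ball bc] conf by auto
  have "measure_pmf.prob (map_pmf (\<lambda>S. S \<inter> {[]}) ?p) {{}} =
      measure_pmf.prob ?p ((\<lambda>S. S \<inter> {[]}) -` {{}} \<inter> set_pmf ?p)"
    by (simp add: measure_Int_set_pmf)
  also have "\<dots> = (\<Sum>S\<in>{S \<in> level_configs s D N. ([] \<in> S) = False}. pmf ?p S)"
    unfolding vim by (rule measure_measure_pmf_finite) (simp add: finite_level_configs)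
  also have "\<dots> = (\<Sum>S\<in>{S \<in> level_configs s D N. ([] \<in> S) = False}.
      fug ^ card S / (\<Sum>T\<in>level_configs s D N. fug ^ card T))"
    by (rule sum.cong) (auto simp: pmf_hardcore[OF fug finite_tree_ball bc] conf)
  also have "\<dots> = root_unocc fug s D N"
    by (simp add: root_unocc_def sum_level_configs partition_fun_def sum_divide_distrib)
  finally show ?thesis .
qed

section \<open>Failure of weak mixing from a gap at the root\<close>

lemma length_le_relpow:
  "(u, v) \<in> adj (tree_graph N) ^^ n \<Longrightarrow> length v \<le> length u + n"
proof (induction n arbitrary: v)
  case (Suc n)
  then obtain w where "(u, w) \<in> adj (tree_graph N) ^^ n" "(w, v) \<in> adj (tree_graph N)" by auto
  then show ?case using Suc.IH[of w] by (auto simp: tree_graph_def)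
qed simp

lemma set_dist_root_tree_level: "enat D \<le> set_dist (tree_graph N) {[]} (tree_level D N)"
proof -
  have "enat D \<le> gdist (tree_graph N) [] v" if "v \<in> tree_level D N" for v
    unfolding gdist_def using that
    by (intro INF_greatest) (auto simp: tree_level_def dest: length_le_relpow)
  then show ?thesis unfolding set_dist_def by (auto intro: INF_greatest)
qed

text \<open>Mixing is tested at the root alone, on balls of radius \<open>D n\<close> with level
  \<open>D n\<close> all occupied or all empty. The event of an unoccupied root bounds the total
  variation distance below by the gap.\<close>

lemma not_WSM_tree:
  assumes fug: "fug > 0" and N: "\<And>v. N v \<ge> 1"
    and D: "strict_mono (D :: nat \<Rightarrow> nat)" and "\<epsilon> > 0"
    and gap: "\<And>n. \<bar>root_unocc fug True (D n) N - root_unocc fug False (D n) N\<bar> \<ge> \<epsilon>"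
  shows "\<not> WSM fug (tree_graph N)"
proof
  assume WSM: "WSM fug (tree_graph N)"
  let ?p = "\<lambda>s n. hardcore fug (tree_graph N) (tree_ball (D n) N) (if s then tree_level (D n) N else {})"
  let ?m = "\<lambda>n. marginal_dist {[]} (?p True n) (?p False n)"
  have bc: "boundary_cond (tree_graph N) (tree_ball (D n) N) (if s then tree_level (D n) N else {})" for s n
    by (rule boundary_cond_tree_ball[OF N])
  have "(\<lambda>n. set_dist (tree_graph N) {[]} (tree_level (D n) N)) \<longlonglongrightarrow> \<infinity>"
  proof (rule order_tendstoI)
    fix a :: enat assume "a < \<infinity>"
    then obtain k where k: "a = enat k" by (cases a) auto
    have "a < set_dist (tree_graph N) {[]} (tree_level (D n) N)" if "n > k" for n
    proof -
      have "a < enat (D n)" using that seq_suble[OF D, of n] by (simp add: k)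
      also have "\<dots> \<le> set_dist (tree_graph N) {[]} (tree_level (D n) N)"
        by (rule set_dist_root_tree_level)
      finally show ?thesis .
    qed
    then show "\<forall>\<^sub>F n in sequentially. a < set_dist (tree_graph N) {[]} (tree_level (D n) N)"
      by (rule eventually_at_top_dense[THEN iffD2, OF exI, rule_format])
  qed simp
  then have "?m \<longlonglongrightarrow> 0"
    using WSM[unfolded WSM_def, rule_format, of "{[]}" "\<lambda>n. tree_ball (D n) N"
        "\<lambda>n. if True then tree_level (D n) N else {}" "\<lambda>n. if False then tree_level (D n) N else {}"]
      bc[of _ True] bc[of _ False]
    by (simp add: boundary_tree_ball[OF N] finite_tree_ball)
       (simp add: tree_ball_def tree_graph_def)
  moreover have "\<epsilon> \<le> ?m n" for n
  proof -
    have "\<bar>root_unocc fug True (D n) N - root_unocc fug False (D n) N\<bar> \<le> ?m n"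
      unfolding marginal_dist_def prob_root_unocc[OF fug N, symmetric] by (rule total_variation_ge)
    with gap[of n] show ?thesis by simp
  qed
  ultimately have "\<epsilon> \<le> 0" by (intro LIMSEQ_le_const) auto
  with \<open>\<epsilon> > 0\<close> show False by simp
qed

section \<open>Large fugacity on the stretched tree\<close>

text \<open>The recursion for the probability that the root is unoccupied, at a vertex with one
  child. At a branching vertex the argument is squared.\<close>

definition path_step :: "real \<Rightarrow> real \<Rightarrow> real" where
  "path_step fug y = 1 / (1 + fug * y)"

text \<open>Generations strictly between \<open>J\<close> and \<open>J + c\<close> have one child
  per vertex, so climbing \<open>k < c\<close> of them from \<open>J + c\<close> meets no
  branching.\<close>

lemma root_unocc_stretched_path:
  assumes fug: "fug > 0" and "c dvd J" "k < c"
  shows "root_unocc fug s (D + k) (stretched c (J + c - k)) =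
    (path_step fug ^^ k) (root_unocc fug s D (stretched c (J + c)))"
  using \<open>k < c\<close>
proof (induction k)
  case (Suc k)
  define q where "q = c - Suc k"
  let ?j = "J + q"
  have "0 < q" "q < c" using Suc.prems by (auto simp: q_def)
  then have "\<not> c dvd ?j"
    using \<open>c dvd J\<close> by (simp add: dvd_add_right_iff nat_dvd_not_less)
  then have "stretched_arity c ?j = 1" by (simp add: stretched_arity_def)
  moreover have "J + c - Suc k = ?j" "Suc ?j = J + c - k"
    using Suc.prems by (simp_all add: q_def)
  ultimately show ?case
    using Suc by (simp add: root_unocc_Suc[OF fug] path_step_def)
qed simp

text \<open>Read upwards: \<open>c - 1\<close> single-child generations, then a branching vertex
  whose two subtrees are equal, which gives the square.\<close>

lemma root_unocc_stretched_block:
  assumes fug: "fug > 0" and "c dvd J" "c > 0"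
  shows "root_unocc fug s (D + c) (stretched c J) =
    path_step fug (((path_step fug ^^ (c - 1)) (root_unocc fug s D (stretched c (J + c))))\<^sup>2)"
proof -
  obtain b where c: "c = Suc b" using \<open>c > 0\<close> by (cases c) auto
  have "root_unocc fug s (D + b) (stretched c (Suc J)) =
      (path_step fug ^^ b) (root_unocc fug s D (stretched c (J + c)))"
    using root_unocc_stretched_path[OF fug \<open>c dvd J\<close>, of b s D] by (simp add: c)
  then have "root_unocc fug s (Suc (D + b)) (stretched c J) =
      path_step fug (((path_step fug ^^ b) (root_unocc fug s D (stretched c (J + c))))\<^sup>2)"
    using \<open>c dvd J\<close>
    by (simp add: root_unocc_Suc[OF fug] path_step_def stretched_arity_def)
  then show ?thesis by (simp add: c)
qed

lemma path_step_pos: "fug > 0 \<Longrightarrow> y \<ge> 0 \<Longrightarrow> path_step fug y > 0"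
  by (simp add: path_step_def add_pos_nonneg)

text \<open>Two steps raise the reciprocal by at most 1, because
  \<open>fug * path_step fug y \<le> 1 / y\<close>.\<close>

lemma path_step_twice_ge:
  assumes "fug > 0" "a > 0" "y \<ge> 1 / a"
  shows "path_step fug (path_step fug y) \<ge> 1 / (a + 1)"
proof -
  have y: "y > 0" using assms by (smt (verit) divide_pos_pos)
  have "1 / y \<le> a" using assms y by (simp add: field_simps)
  have "fug * path_step fug y \<le> 1 / y"
    using assms(1) y by (simp add: path_step_def divide_simps add_pos_pos)
  then have "1 + fug * path_step fug y \<le> a + 1" using \<open>1 / y \<le> a\<close> by simp
  moreover have "1 + fug * path_step fug y > 0"
    using assms(1) path_step_pos[of fug y] y by (simp add: add_pos_pos)
  ultimately show ?thesis
    unfolding path_step_def[of fug "path_step fug y"] by (intro divide_left_mono) (use assms in auto)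
qed

text \<open>Dropping the 1 in the outer denominator leaves \<open>(1 + fug * y) / fug\<close>, so
  two steps raise the value by at most \<open>1 / fug\<close>.\<close>

lemma path_step_twice_le:
  assumes "fug > 0" "y \<ge> 0"
  shows "path_step fug (path_step fug y) \<le> y + 1 / fug"
proof -
  have p: "path_step fug y > 0" by (rule path_step_pos[OF assms])
  have "path_step fug (path_step fug y) \<le> 1 / (fug * path_step fug y)"
    using assms(1) p unfolding path_step_def[of fug "path_step fug y"]
    by (intro divide_left_mono mult_pos_pos add_pos_pos) auto
  also have "\<dots> = y + 1 / fug"
    using assms by (simp add: path_step_def field_simps add_nonneg_eq_0_iff)
  finally show ?thesis .
qed

lemma path_step_even_ge:
  assumes "fug > 0" "a > 0" "y \<ge> 1 / a"
  shows "(path_step fug ^^ (2 * m)) y \<ge> 1 / (a + real m)"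
proof (induction m)
  case (Suc m)
  then show ?case
    using path_step_twice_ge[OF assms(1) _ Suc] assms(2) by (simp add: algebra_simps)
qed (use assms in simp)

lemma path_step_even_le:
  assumes "fug > 0" "y \<ge> 0"
  shows "0 \<le> (path_step fug ^^ (2 * m)) y \<and> (path_step fug ^^ (2 * m)) y \<le> y + real m / fug"
proof (induction m)
  case (Suc m)
  let ?z = "(path_step fug ^^ (2 * m)) y"
  have "path_step fug (path_step fug ?z) \<le> ?z + 1 / fug" "path_step fug (path_step fug ?z) > 0"
    using Suc path_step_twice_le[OF assms(1)] path_step_pos[OF assms(1)] less_imp_le by (blast, metis)
  then show ?case using Suc by (simp add: add_divide_distrib)
qed (use assms in simp)

text \<open>For an odd number \<open>2 * m + 1\<close> of generations per block, the block recursion is decreasing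
  and, for large fugacity, interchanges a neighbourhood of 0 and a neighbourhood of 1.\<close>

context
  fixes m :: nat and fug :: real
  assumes fug: "fug \<ge> ((real m + 2)\<^sup>2 + real m)\<^sup>2"
begin

text \<open>The second bound keeps the low interval, ending at
  \<open>(real m + 2)\<^sup>2 / fug\<close>, at distance at least 1/4 from the high interval, which
  starts at 1/2.\<close>

lemma fugacity_bounds: "fug \<ge> 16" "(real m + 2)\<^sup>2 / fug \<le> 1 / 4"
proof -
  let ?b = "(real m + 2)\<^sup>2" and ?K = "(real m + 2)\<^sup>2 + real m"
  have "(2::real)\<^sup>2 \<le> ?b" by (intro power_mono) auto
  then have b: "?b \<ge> 4" by simp
  then have "?K * 4 \<le> ?K * ?K" by (intro mult_left_mono) auto
  then have K: "4 * ?K \<le> ?K\<^sup>2" by (simp add: power2_eq_square)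
  show "fug \<ge> 16" using b K fug by simp
  have "4 * ?b \<le> fug" using K fug by simp
  then show "?b / fug \<le> 1 / 4" using \<open>fug \<ge> 16\<close> by (simp add: field_simps)
qed

lemma fug_pos: "fug > 0"
  using fugacity_bounds(1) by simp

definition block_step :: "real \<Rightarrow> real" where
  "block_step y = path_step fug (((path_step fug ^^ (2 * m)) y)\<^sup>2)"

text \<open>The reciprocal starts at most 2 and grows by at most \<open>m\<close> over the
  \<open>2 * m\<close> path steps, so \<open>?z \<ge> 1 / (2 + real m)\<close>; the last step is at
  most \<open>1 / (fug * ?z\<^sup>2)\<close>.\<close>

lemma block_step_high_low:
  assumes "y \<ge> 1 / 2"
  shows "0 \<le> block_step y" "block_step y \<le> (real m + 2)\<^sup>2 / fug"
proof -
  let ?z = "(path_step fug ^^ (2 * m)) y"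
  show "0 \<le> block_step y"
    unfolding block_step_def using path_step_pos[OF fug_pos, of "?z\<^sup>2"] by simp
  have "?z \<ge> 1 / (2 + real m)" by (rule path_step_even_ge[OF fug_pos _ assms]) simp
  then have "?z\<^sup>2 \<ge> (1 / (2 + real m))\<^sup>2" by (intro power_mono) auto
  then have "fug * (1 / (2 + real m))\<^sup>2 \<le> 1 + fug * ?z\<^sup>2"
    using mult_left_mono[of "(1 / (2 + real m))\<^sup>2" "?z\<^sup>2" fug] fug_pos by linarith
  moreover have "0 < fug * (1 / (2 + real m))\<^sup>2" using fug_pos by (intro mult_pos_pos) auto
  ultimately have "block_step y \<le> 1 / (fug * (1 / (2 + real m))\<^sup>2)"
    unfolding block_step_def path_step_def[of fug "?z\<^sup>2"]
    by (intro divide_left_mono) (auto intro: mult_pos_pos)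
  then show "block_step y \<le> (real m + 2)\<^sup>2 / fug"
    by (simp add: power_divide add.commute)
qed

text \<open>The path steps add at most \<open>m / fug\<close>, so \<open>?z \<le> ?K / fug\<close>
  and \<open>fug * ?z\<^sup>2 \<le> ?K\<^sup>2 / fug\<close>. The assumed size of \<open>fug\<close>
  is exactly what makes this at most 1.\<close>

lemma block_step_low_high:
  assumes "0 \<le> y" "y \<le> (real m + 2)\<^sup>2 / fug"
  shows "block_step y \<ge> 1 / 2"
proof -
  let ?z = "(path_step fug ^^ (2 * m)) y" and ?K = "(real m + 2)\<^sup>2 + real m"
  have "0 \<le> ?z" "?z \<le> ?K / fug"
    using path_step_even_le[OF fug_pos assms(1), of m] assms(2) by (auto simp: add_divide_distrib)
  then have "?z\<^sup>2 \<le> (?K / fug)\<^sup>2" by (intro power_mono)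
  then have "fug * ?z\<^sup>2 \<le> fug * (?K / fug)\<^sup>2" using fug_pos by (intro mult_left_mono) auto
  also have "\<dots> = ?K\<^sup>2 / fug" using fug_pos by (simp add: power_divide power2_eq_square)
  also have "\<dots> \<le> 1" using fug fug_pos by simp
  finally have "1 + fug * ?z\<^sup>2 \<le> 2" by simp
  moreover have "1 + fug * ?z\<^sup>2 > 0" using fug_pos by (simp add: add_pos_nonneg)
  ultimately show ?thesis
    unfolding block_step_def path_step_def[of fug "?z\<^sup>2"] by (intro divide_left_mono) auto
qed

text \<open>The occupied boundary starts at 0 and the empty one at 1, and each block swaps low and
  high. \<open>J\<close> varies because the block at \<open>J\<close> refers to the subtrees at
  \<open>J + (2 * m + 1)\<close>.\<close>

lemma root_unocc_stretched_alternates: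
  assumes "(2 * m + 1) dvd J"
  shows "if even n \<longleftrightarrow> s
    then 0 \<le> root_unocc fug s ((2 * m + 1) * n) (stretched (2 * m + 1) J) \<and>
      root_unocc fug s ((2 * m + 1) * n) (stretched (2 * m + 1) J) \<le> (real m + 2)\<^sup>2 / fug
    else root_unocc fug s ((2 * m + 1) * n) (stretched (2 * m + 1) J) \<ge> 1 / 2"
  using assms
proof (induction n arbitrary: J)
  case 0
  then show ?case using fug_pos by (simp add: root_unocc_0)
next
  case (Suc n)
  let ?c = "2 * m + 1"
  let ?y = "root_unocc fug s (?c * n) (stretched ?c (J + ?c))"
  have "root_unocc fug s (?c * Suc n) (stretched ?c J) = block_step ?y"
    using root_unocc_stretched_block[OF fug_pos Suc.prems, of s "?c * n"]
    by (simp add: block_step_def add.commute)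
  moreover have "?c dvd J + ?c" by (intro dvd_add Suc.prems dvd_refl)
  ultimately show ?case
    using Suc.IH[of "J + ?c"] block_step_high_low[of ?y] block_step_low_high[of ?y]
    by (auto split: if_splits)
qed

lemma not_WSM_stretched_binary_tree: "\<not> WSM fug (stretched_binary_tree (2 * m + 1))"
  unfolding stretched_binary_tree_eq
proof (rule not_WSM_tree[where D = "\<lambda>n. (2 * m + 1) * n" and \<epsilon> = "1 / 4"])
  show "1 \<le> stretched (2 * m + 1) 0 v" for v
    by (simp add: stretched_def stretched_arity_def)
  show "strict_mono (\<lambda>n. (2 * m + 1) * n)" by (intro strict_monoI mult_strict_left_mono) auto
  show "1 / 4 \<le> \<bar>root_unocc fug True ((2 * m + 1) * n) (stretched (2 * m + 1) 0) -
      root_unocc fug False ((2 * m + 1) * n) (stretched (2 * m + 1) 0)\<bar>" for n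
  proof -
    define y where "y s = root_unocc fug s ((2 * m + 1) * n) (stretched (2 * m + 1) 0)" for s
    define u where "u = (real m + 2)\<^sup>2 / fug"
    have "if even n \<longleftrightarrow> s then 0 \<le> y s \<and> y s \<le> u else y s \<ge> 1 / 2" for s
      unfolding y_def u_def by (rule root_unocc_stretched_alternates) simp
    \<comment> \<open>For either parity of \<open>n\<close>, one of the two values is at most 1/4
      and the other at least 1/2.\<close>
    from this[of True] this[of False] fugacity_bounds(2)[folded u_def]
    show ?thesis
      unfolding y_def[symmetric] by (cases "even n") simp_all
  qed
qed (use fug_pos in simp_all)

end

theorem mainTheorem4:
  fixes d :: real
  assumes "d > 1"
  shows "(\<exists>fug>0. with_positive_prob (poisson_tree_space d)
            (\<lambda>N. \<not> SSM fug (tree_graph N))) \<and>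
         (\<exists>c\<ge>1. with_positive_prob (poisson_tree_space d)
            (\<lambda>N. \<exists>H. subgraph H (tree_graph N) \<and> graph_iso (stretched_binary_tree c) H) \<and>
            (\<exists>fug0>0. \<forall>fug\<ge>fug0. \<not> WSM fug (stretched_binary_tree c)))"
proof -
  obtain m where m: "measure (poisson_tree_space d) (branching (2 * m)) > 0"
    using measure_branching_pos[OF assms] .
  let ?c = "2 * m + 1" and ?fug0 = "((real m + 2)\<^sup>2 + real m)\<^sup>2"
  have sub: "\<exists>H. subgraph H (tree_graph N) \<and> graph_iso (stretched_binary_tree ?c) H"
    if "N \<in> branching (2 * m)" for N
    by (rule stretched_subgraph_of_branching) (use that in auto)
  have pos: "?fug0 > 0" using fug_pos[of m ?fug0] by simp
  \<comment> \<open>The threshold itself serves as the fugacity, and the event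
    \<open>branching (2 * m)\<close> serves both probability claims.\<close>
  have "\<not> SSM ?fug0 (tree_graph N)" if N: "N \<in> branching (2 * m)" for N
  proof -
    obtain H where H: "subgraph H (tree_graph N)" "graph_iso (stretched_binary_tree ?c) H"
      using sub[OF N] by blast
    have "\<not> WSM ?fug0 H"
      using not_WSM_stretched_binary_tree[of m ?fug0] WSM_graph_iso[OF H(2) _ _ pos] H(1)
        simple_graph_tree_graph by (auto simp: subgraph_def stretched_binary_tree_def)
    then show ?thesis using H(1) by (auto simp: SSM_def)
  qed
  moreover have "\<forall>fug\<ge>?fug0. \<not> WSM fug (stretched_binary_tree ?c)"
    using not_WSM_stretched_binary_tree by blast
  ultimately show ?thesis
    unfolding with_positive_prob_def using m pos sub sets_branching[of "2 * m" d]
    by (intro conjI exI[of _ ?fug0] exI[of _ ?c] bexI[of _ "branching (2 * m)"]) auto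
qed

end
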